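(* Let $f:\mathbb{R}\to\mathbb{R}$ be a smooth function and let $R>0$. There is a constant $a_0>0$ (depending on $f$ and $R$) such that for every $a\ge a_0$ and every continuous function $q:\mathbb{R}^3\to\mathbb{R}$ with $q(x)\ge a^2$ for all $x\in\mathbb{R}^3$ ($q$ may be unbounded and grow to infinity as $|x|\to\infty$) the following holds. (1) For every $\varepsilon>0$ the problem $$-\varepsilon^2\Delta u_\varepsilon+q(x)u_\varepsilon=f(u_\varepsilon)\ \text{ in }\mathbb{R}^3,\qquad |u_\varepsilon(\infty)|<\infty,$$ has a unique solution $u_\varepsilon$ in the ball $B_R$, and $u_\varepsilon\not\equiv0$ if $f(0)\ne0$. (2) If, in addition, for some $u_0>0$ the function $\frac{f(u)}{u}$ is monotonically growing to infinity on $[u_0,\infty)$ and $\frac{f(u_0)}{u_0}<a^2$, then $$\lim_{\varepsilon\to0}u_\varepsilon(x)=u(x)\qquad\text{for every }x\in\mathbb{R}^3,$$ where $u$ solves the limiting equation $q(x)u(x)=f(u(x))$, $x\in\mathbb{R}^3$.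
   Context: $B_R$ is the set of continuous bounded functions $v$ on $\mathbb{R}^3$ with $\sup_{x\in\mathbb{R}^3}|v(x)|\le R$. The condition $|u_\varepsilon(\infty)|<\infty$ means that $u_\varepsilon$ stays bounded at infinity; it holds automatically for $u_\varepsilon\in B_R$. Since $q$ is only continuous, the differential equation is understood in the sense of distributions. *)

theory Defs
  imports "HOL-Analysis.Analysis"
begin

definition pderiv_dir :: "'a::euclidean_space \<Rightarrow> ('a \<Rightarrow> real) \<Rightarrow> 'a \<Rightarrow> real" where
  "pderiv_dir b g = (\<lambda>x. frechet_derivative g (at x) b)"

fun C_k :: "nat \<Rightarrow> ('a::euclidean_space \<Rightarrow> real) \<Rightarrow> bool" where
  "C_k 0 g \<longleftrightarrow> continuous_on UNIV g"
| "C_k (Suc k) g \<longleftrightarrow> g differentiable_on UNIV \<and> (\<forall>b\<in>Basis. C_k k (pderiv_dir b g))"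

definition smooth :: "('a::euclidean_space \<Rightarrow> real) \<Rightarrow> bool" where
  "smooth g \<longleftrightarrow> (\<forall>k. C_k k g)"

definition test_function :: "('a::euclidean_space \<Rightarrow> real) \<Rightarrow> bool" where
  "test_function \<phi> \<longleftrightarrow> smooth \<phi> \<and> compact (closure (support_on UNIV \<phi>))"

definition laplacian :: "('a::euclidean_space \<Rightarrow> real) \<Rightarrow> 'a \<Rightarrow> real" where
  "laplacian g x = (\<Sum>b\<in>Basis. pderiv_dir b (pderiv_dir b g) x)"

definition B_ball :: "real \<Rightarrow> (real^3 \<Rightarrow> real) set" where
  "B_ball R = {v. continuous_on UNIV v \<and> bounded (range v) \<and> (SUP x. \<bar>v x\<bar>) \<le> R}"

(* The equation in the sense of distributions: both sides are paired with test functions, and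
   the distributional Laplacian of u sends \<phi> to the integral of u times the Laplacian of \<phi>.
   It is meant for continuous u, q and f, for which all three integrands are integrable. *)
definition distributional_solution ::
    "real \<Rightarrow> (real^3 \<Rightarrow> real) \<Rightarrow> (real \<Rightarrow> real) \<Rightarrow> (real^3 \<Rightarrow> real) \<Rightarrow> bool" where
  "distributional_solution \<epsilon> q f u \<longleftrightarrow>
     (\<forall>\<phi>. test_function \<phi> \<longrightarrow>
        - (\<epsilon>\<^sup>2 * (LINT x|lborel. u x * laplacian \<phi> x)) + (LINT x|lborel. q x * u x * \<phi> x)
          = (LINT x|lborel. f (u x) * \<phi> x))"

definition bounded_at_infinity :: "(real^3 \<Rightarrow> real) \<Rightarrow> bool" where
  "bounded_at_infinity u \<longleftrightarrow> (\<exists>C. \<forall>\<^sub>F x in at_infinity. \<bar>u x\<bar> \<le> C)"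

definition solves_problem ::
    "real \<Rightarrow> (real^3 \<Rightarrow> real) \<Rightarrow> (real \<Rightarrow> real) \<Rightarrow> (real^3 \<Rightarrow> real) \<Rightarrow> bool" where
  "solves_problem \<epsilon> q f u \<longleftrightarrow> distributional_solution \<epsilon> q f u \<and> bounded_at_infinity u"

end

(* Existence: replace the Laplacian by second differences of step h. The discrete equation is a
   contraction on bounded continuous functions, and comparing u(x + z) - u(x) with the paraboloids
   k + c|x - x1|^2, whose second differences are constant, makes its solutions equicontinuous at
   every point uniformly in h, although q is neither bounded nor uniformly continuous. A pointwise
   limit along a subsequence solves the equation, the differences being moved to test functions.

   Uniqueness and the limit eps -> 0: the same comparison with paraboloids holds for continuous
   functions with a continuous distributional Laplacian. The paraboloids may be taken arbitrarily
   small for the difference of two solutions, and for u_eps near x0 one compares with paraboloids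
   around the root s of q(x0) s = f(s). *)

theory Submission
  imports Defs "HOL-Complex_Analysis.Great_Picard"
begin

section \<open>Bump functions\<close>

text \<open>The size of \<open>q\<close> enters through one inequality. With \<open>f\<close>
  replaced by its composition \<open>F\<close> with the retraction onto \<open>[-R, R]\<close>,
  \<open>q x * w - \<bar>F s - F t\<bar> \<ge> w\<close> holds for
  \<open>w = \<bar>s - t\<bar> > 0\<close>: the zeroth-order term beats the nonlinearity with a
  fixed margin. So wherever a difference of two candidate functions is large, its Laplacian is
  bounded below by a positive constant, and a comparison turns this into a contradiction. The
  obstacle is the whole space: a bounded continuous function need not attain its supremum, and
  \<open>q\<close> has no modulus of continuity valid everywhere. Subtracting c|x - x0|^2 cures
  both. The maximum is attained, and a bounded function can exceed k + c|x - x0|^2 only in a ball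
  whose radius is known from the bound and c; on that ball \<open>q\<close> is uniformly continuous.
  The price is the Laplacian 2 c times the dimension of the paraboloid, which must stay below the
  lower bound just mentioned. Every choice of c below balances these two demands.\<close>

lemma C_k_of_closed_class:
  fixes S :: "('a::euclidean_space \<Rightarrow> real) set"
  assumes D: "\<And>g. g \<in> S \<Longrightarrow> g differentiable_on UNIV"
    and P: "\<And>g b. g \<in> S \<Longrightarrow> pderiv_dir b g \<in> S"
  shows "g \<in> S \<Longrightarrow> C_k k g"
proof (induction k arbitrary: g)
  case 0
  then show ?case using D by (simp add: differentiable_imp_continuous_on)
next
  case (Suc k)
  then show ?case using D P by simp
qed

text \<open>\<open>flat 0\<close> is the classical function exp(-1/t), extended by 0.
  Differentiation produces negative powers of t, so these are built in and the family spans a space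
  closed under derivatives.\<close>

definition flat :: "nat \<Rightarrow> real \<Rightarrow> real" where
  "flat j t = (if t > 0 then exp (- 1 / t) / t ^ j else 0)"

lemma power_div_fact_le_exp:
  fixes s :: real
  assumes "s \<ge> 0"
  shows "s ^ n / fact n \<le> exp s"
proof -
  have "(\<Sum>n\<in>{n}. s ^ n /\<^sub>R fact n) \<le> (\<Sum>n. s ^ n /\<^sub>R fact n)"
    by (rule sum_le_suminf) (use summable_exp_generic[of s] assms in auto)
  then show ?thesis by (simp add: exp_def divide_inverse mult.commute)
qed

text \<open>A single term of the exponential series at 1/t already gives exp(-1/t) \<le> (j+1)!
  t^(j+1). The linear bound is what makes each \<open>flat j\<close> continuous at 0.\<close>

lemma flat_le: "\<bar>flat j t\<bar> \<le> fact (Suc j) * \<bar>t\<bar>"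
proof (cases "t > 0")
  case True
  have "(1/t) ^ Suc j / fact (Suc j) \<le> exp (1/t)"
    using True by (intro power_div_fact_le_exp) auto
  then have "1 \<le> exp (1/t) * (fact (Suc j) * (t * t ^ j))"
    using True by (simp add: field_simps del: fact_Suc)
  then have "exp (- 1 / t) \<le> fact (Suc j) * (t * t ^ j)"
    by (simp add: exp_minus field_simps del: fact_Suc)
  then show ?thesis using True by (simp add: flat_def field_simps del: fact_Suc)
qed (simp add: flat_def mult_le_0_iff del: fact_Suc)

lemma flat_has_derivative:
  "(flat j has_real_derivative flat (j + 2) t - real j * flat (j + 1) t) (at t)"
proof -
  consider "t > 0" | "t < 0" | "t = 0" by linarith
  then show ?thesis
  proof cases
    case 1
    have "((\<lambda>t. exp (- 1 / t) / t ^ j) has_real_derivative flat (j + 2) t - real j * flat (j + 1) t) (at t)"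
      using 1 apply (auto intro!: derivative_eq_intros simp: flat_def)
      apply (cases j) apply (auto simp: field_simps power2_eq_square)
      done
    then show ?thesis
      by (rule has_field_derivative_transform_within_open[where S="{0<..}"]) (use 1 in \<open>auto simp: flat_def\<close>)
  next
    case 2
    have "((\<lambda>t. 0) has_real_derivative flat (j + 2) t - real j * flat (j + 1) t) (at t)"
      using 2 by (simp add: flat_def)
    then show ?thesis
      by (rule has_field_derivative_transform_within_open[where S="{..<0}"]) (use 2 in \<open>auto simp: flat_def\<close>)
  next
    case 3
    have "(flat (j + 1) \<longlongrightarrow> 0) (at 0)"
    proof (rule Lim_null_comparison)
      show "\<forall>\<^sub>F t in at 0. norm (flat (j + 1) t) \<le> fact (Suc (j+1)) * \<bar>t\<bar>"
        using flat_le[of "j+1"] by (simp del: fact_Suc)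
      show "((\<lambda>t. fact (Suc (j+1)) * \<bar>t\<bar>) \<longlongrightarrow> (0::real)) (at 0)"
        by (auto intro!: tendsto_eq_intros)
    qed
    \<comment> \<open>The difference quotient at 0 is itself a member of the family, so
      differentiability at 0 reduces to the limit just shown. At h = 0 both sides are 0, by the
      convention for division by zero.\<close>
    moreover have "(\<lambda>h. (flat j (0 + h) - flat j 0) / h) = flat (j + 1)"
      by (auto simp: flat_def fun_eq_iff)
    ultimately show ?thesis using 3 unfolding DERIV_def by (simp add: flat_def)
  qed
qed

text \<open>\<open>C_k\<close> recurses through directional derivatives, so smoothness follows at
  all orders at once for members of a class closed under \<open>pderiv_dir\<close>. This algebra is
  such a class: \<open>coord\<close> is present because the chain rule applied to |x - c|^2 produces
  the factor (x - c) . b, and products come from the chain and product rules.\<close>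

inductive_set bump_algebra :: "'a::euclidean_space \<Rightarrow> real \<Rightarrow> ('a \<Rightarrow> real) set" for c r where
  flat: "(\<lambda>x. flat j (r\<^sup>2 - (norm (x - c))\<^sup>2)) \<in> bump_algebra c r"
| const: "(\<lambda>x. k) \<in> bump_algebra c r"
| coord: "(\<lambda>x. (x - c) \<bullet> b) \<in> bump_algebra c r"
| add: "g \<in> bump_algebra c r \<Longrightarrow> h \<in> bump_algebra c r \<Longrightarrow> (\<lambda>x. g x + h x) \<in> bump_algebra c r"
| mult: "g \<in> bump_algebra c r \<Longrightarrow> h \<in> bump_algebra c r \<Longrightarrow> (\<lambda>x. g x * h x) \<in> bump_algebra c r"

lemma bump_algebra_derivative:
  assumes "g \<in> bump_algebra c r"
  shows "\<exists>D. (\<forall>x. (g has_derivative D x) (at x)) \<and> (\<forall>b. (\<lambda>x. D x b) \<in> bump_algebra c r)"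
  using assms
proof induction
  case (flat j)
  let ?F = "\<lambda>x. flat (j + 2) (r\<^sup>2 - (norm (x - c))\<^sup>2) + (- real j) * flat (j + 1) (r\<^sup>2 - (norm (x - c))\<^sup>2)"
  have "((\<lambda>x. flat j (r\<^sup>2 - (norm (x - c))\<^sup>2)) has_derivative (\<lambda>v. ?F x * ((-2) * ((x - c) \<bullet> v)))) (at x)" for x
  proof -
    have s: "((\<lambda>x. r\<^sup>2 - (norm (x - c))\<^sup>2) has_derivative (\<lambda>v. (-2) * ((x - c) \<bullet> v))) (at x)"
      unfolding power2_norm_eq_inner
      by (auto intro!: derivative_eq_intros simp: inner_commute)
    have "((flat j) has_derivative (*) (?F x)) (at (r\<^sup>2 - (norm (x - c))\<^sup>2))"
      using flat_has_derivative[of j "r\<^sup>2 - (norm (x - c))\<^sup>2"] by (simp add: has_field_derivative_def)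
    from has_derivative_compose[OF s this] show ?thesis by simp
  qed
  moreover have "(\<lambda>x. ?F x * ((-2) * ((x - c) \<bullet> b))) \<in> bump_algebra c r" for b
    by (intro bump_algebra.intros)
  ultimately show ?case
    by (intro exI[of _ "\<lambda>x v. ?F x * ((-2) * ((x - c) \<bullet> v))"]) blast
next
  case (const k)
  show ?case by (rule exI[of _ "\<lambda>_ _. 0"]) (auto intro: bump_algebra.const)
next
  case (coord b)
  show ?case by (rule exI[of _ "\<lambda>x v. v \<bullet> b"]) (auto intro!: bump_algebra.const derivative_eq_intros)
next
  case (add g h)
  then obtain D E where "\<forall>x. (g has_derivative D x) (at x)" "\<forall>b. (\<lambda>x. D x b) \<in> bump_algebra c r"
    "\<forall>x. (h has_derivative E x) (at x)" "\<forall>b. (\<lambda>x. E x b) \<in> bump_algebra c r" by blast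
  then show ?case
    by (intro exI[of _ "\<lambda>x v. D x v + E x v"]) (auto intro: bump_algebra.add has_derivative_add)
next
  case (mult g h)
  then obtain D E where "\<forall>x. (g has_derivative D x) (at x)" "\<forall>b. (\<lambda>x. D x b) \<in> bump_algebra c r"
    "\<forall>x. (h has_derivative E x) (at x)" "\<forall>b. (\<lambda>x. E x b) \<in> bump_algebra c r" by blast
  with mult.hyps show ?case
    by (intro exI[of _ "\<lambda>x v. g x * E x v + D x v * h x"])
       (auto intro!: bump_algebra.add bump_algebra.mult has_derivative_mult)
qed

lemma smooth_bump_algebra:
  assumes "g \<in> bump_algebra c r"
  shows "smooth g"
  unfolding smooth_def
proof
  fix k
  show "C_k k g"
  proof (rule C_k_of_closed_class[of "bump_algebra c r"])
    fix g :: "'a \<Rightarrow> real" and b assume "g \<in> bump_algebra c r"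
    then obtain D where D: "\<And>x. (g has_derivative D x) (at x)" "\<And>b. (\<lambda>x. D x b) \<in> bump_algebra c r"
      using bump_algebra_derivative by blast
    show "g differentiable_on UNIV"
      using D(1) by (auto simp: differentiable_on_def differentiable_def)
    have "pderiv_dir b g = (\<lambda>x. D x b)"
      unfolding pderiv_dir_def using frechet_derivative_at[OF D(1)] by metis
    then show "pderiv_dir b g \<in> bump_algebra c r" using D(2) by simp
  qed (use assms in auto)
qed

definition bump :: "'a::euclidean_space \<Rightarrow> real \<Rightarrow> 'a \<Rightarrow> real" where
  "bump c r x = flat 0 (r\<^sup>2 - (norm (x - c))\<^sup>2)"

lemma bump_pos_iff: "r > 0 \<Longrightarrow> bump c r x > 0 \<longleftrightarrow> norm (x - c) < r"
  unfolding bump_def flat_def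
  by (auto simp: abs_le_square_iff[symmetric] not_less dest: power2_less_imp_less intro: power_strict_mono)

lemma bump_nonneg: "bump c r x \<ge> 0"
  by (simp add: bump_def flat_def)

lemma bump_eq_0: "r > 0 \<Longrightarrow> norm (x - c) \<ge> r \<Longrightarrow> bump c r x = 0"
  by (metis bump_nonneg bump_pos_iff not_less order_le_less)

lemma bump_translate: "bump c r x = bump 0 r (x - c)"
  by (simp add: bump_def)

lemma smooth_scaled_bump: "smooth (\<lambda>x. k * bump c r x)"
  unfolding bump_def
  by (rule smooth_bump_algebra[of _ c r]) (intro bump_algebra.intros)

lemma test_functionI:
  fixes g :: "'a::euclidean_space \<Rightarrow> real"
  assumes "smooth g" and "\<And>x. norm (x - c) \<ge> r \<Longrightarrow> g x = 0"
  shows "test_function g"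
proof -
  have "support_on UNIV g \<subseteq> cball c r"
    using assms(2) by (force simp: support_on_def dist_norm norm_minus_commute)
  then show ?thesis unfolding test_function_def using assms(1)
    by (meson bounded_cball bounded_subset compact_closure)
qed

lemma test_function_scaled_bump: "r > 0 \<Longrightarrow> test_function (\<lambda>x. k * bump c r x)"
  by (rule test_functionI[where c = c and r = r]) (auto simp: smooth_scaled_bump bump_eq_0)


section \<open>Test functions and second differences\<close>

text \<open>The standard finite-difference Laplacian, taken at every point of the space and not on a
  grid, so that it maps continuous functions on the space to continuous functions.\<close>

definition dlap :: "real \<Rightarrow> ('a::euclidean_space \<Rightarrow> real) \<Rightarrow> 'a \<Rightarrow> real" where
  "dlap h u x = (\<Sum>b\<in>Basis. u (x + h *\<^sub>R b) + u (x - h *\<^sub>R b) - 2 * u x) / h\<^sup>2"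

lemma integrable_continuous_bounded_support:
  fixes g :: "'a::euclidean_space \<Rightarrow> real"
  assumes "continuous_on UNIV g" and "\<And>x. norm x > r \<Longrightarrow> g x = 0"
  shows "integrable lborel g"
proof -
  have "integrable lborel (\<lambda>x. indicator (cball 0 r) x *\<^sub>R g x)"
    by (rule borel_integrable_compact) (use assms(1) in \<open>auto intro: continuous_on_subset\<close>)
  moreover have "(\<lambda>x. indicator (cball 0 r) x *\<^sub>R g x) = g"
    using assms(2) by (auto simp: fun_eq_iff indicator_def)
  ultimately show ?thesis by simp
qed

lemma test_function_support:
  assumes "test_function \<phi>"
  obtains r where "r > 0" "\<And>x. norm x > r \<Longrightarrow> \<phi> x = 0"
proof -
  have "bounded (closure (support_on UNIV \<phi>))"
    using assms by (simp add: test_function_def compact_imp_bounded)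
  then obtain r where r: "r > 0" "\<forall>x\<in>closure (support_on UNIV \<phi>). norm x \<le> r"
    unfolding bounded_pos by blast
  have "\<phi> x = 0" if "norm x > r" for x
    using r(2) that closure_subset[of "support_on UNIV \<phi>"] by (force simp: support_on_def)
  with r(1) that show ?thesis by blast
qed

lemma test_function_continuous: "test_function \<phi> \<Longrightarrow> continuous_on UNIV \<phi>"
  unfolding test_function_def smooth_def using C_k.simps(1) by blast

lemma C_k_Suc_directional_derivative:
  assumes "C_k (Suc k) g"
  shows "((\<lambda>t. g (x + t *\<^sub>R b)) has_real_derivative pderiv_dir b g (x + t *\<^sub>R b)) (at t)"
proof -
  let ?D = "frechet_derivative g (at (x + t *\<^sub>R b))"
  have g: "(g has_derivative ?D) (at (x + t *\<^sub>R b))"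
    using assms frechet_derivative_works by (auto simp: differentiable_on_def)
  have "((\<lambda>t. x + t *\<^sub>R b) has_derivative (\<lambda>s. s *\<^sub>R b)) (at t)"
    by (auto intro!: derivative_eq_intros)
  from has_derivative_compose[OF this g]
  have "((\<lambda>t. g (x + t *\<^sub>R b)) has_derivative (\<lambda>s. ?D (s *\<^sub>R b))) (at t)" .
  moreover have "?D (s *\<^sub>R b) = s * ?D b" for s
    using has_derivative_linear[OF g] by (simp add: linear_cmul)
  ultimately show ?thesis
    by (simp add: has_field_derivative_def pderiv_dir_def mult_commute_abs)
qed

text \<open>Taylor's formula with Lagrange remainder is used from 0 to h and from 0 to -h. The
  first-order terms cancel, and the two remainders survive at points that may differ. The formula is
  exact, so it yields both the bound uniform in h and the limit.\<close>

lemma second_difference: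
  assumes "C_k 2 g" "b \<in> Basis" "h > 0"
  obtains s t where "\<bar>s\<bar> \<le> h" "\<bar>t\<bar> \<le> h"
    "g (x + h *\<^sub>R b) + g (x - h *\<^sub>R b) - 2 * g x =
       h\<^sup>2 * ((pderiv_dir b (pderiv_dir b g) (x + s *\<^sub>R b) + pderiv_dir b (pderiv_dir b g) (x + t *\<^sub>R b)) / 2)"
proof -
  \<comment> \<open>The derivatives along the line through x in direction b, arranged as the indexed
    sequence that Taylor's theorem expects.\<close>
  define d where "d m t = (case m of 0 \<Rightarrow> g (x + t *\<^sub>R b) | Suc 0 \<Rightarrow> pderiv_dir b g (x + t *\<^sub>R b)
    | _ \<Rightarrow> pderiv_dir b (pderiv_dir b g) (x + t *\<^sub>R b))" for m :: nat and t
  have c: "C_k (Suc 1) g" "C_k (Suc 0) (pderiv_dir b g)"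
    using assms(1,2) by (auto simp: numeral_2_eq_2)
  have d: "d 0 = (\<lambda>t. g (x + t *\<^sub>R b))" "d (Suc 0) = (\<lambda>t. pderiv_dir b g (x + t *\<^sub>R b))"
    "d (Suc (Suc 0)) = (\<lambda>t. pderiv_dir b (pderiv_dir b g) (x + t *\<^sub>R b))"
    by (auto simp: d_def)
  have D: "\<forall>m t. m < 2 \<and> -h \<le> t \<and> t \<le> h \<longrightarrow> DERIV (d m) t :> d (Suc m) t"
    using C_k_Suc_directional_derivative[OF c(1)] C_k_Suc_directional_derivative[OF c(2)]
    by (auto simp: d less_2_cases_iff)
  obtain s where s: "0 < s" "s < h" "d 0 h = (\<Sum>m<2. (d m 0 / fact m) * (h - 0)^m) + (d 2 s / fact 2) * (h - 0)^2"
    using Taylor_up[of 2 d "d 0" "-h" h 0] D assms(3) by auto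
  obtain t where t: "-h < t" "t < 0" "d 0 (-h) = (\<Sum>m<2. (d m 0 / fact m) * (-h - 0)^m) + (d 2 t / fact 2) * (-h - 0)^2"
    using Taylor_down[of 2 d "d 0" "-h" h 0] D assms(3) by auto
  have "d 0 h + d 0 (-h) - 2 * d 0 0 = h\<^sup>2 * ((d 2 s + d 2 t) / 2)"
    unfolding s(3) t(3) by (simp add: numeral_2_eq_2 lessThan_Suc) (simp add: field_simps power2_eq_square)
  then show ?thesis
    using s(1,2) t(1,2) by (intro that[of s t]) (auto simp: d numeral_2_eq_2)
qed

lemma pderiv_dir_zero_outside:
  assumes "\<And>x. norm x > r \<Longrightarrow> g x = 0" "norm x > r"
  shows "pderiv_dir b g x = 0"
proof -
  have "(g has_derivative (\<lambda>_. 0)) (at x)"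
  proof (rule has_derivative_transform_within_open)
    show "((\<lambda>_. 0) has_derivative (\<lambda>_. 0)) (at x)" by simp
    show "open {x. norm x > r}" by (intro open_Collect_less continuous_intros)
  qed (use assms in auto)
  from frechet_derivative_at[OF this] show ?thesis by (metis pderiv_dir_def)
qed

lemma test_function_C2:
  assumes "test_function \<phi>"
  shows "C_k 2 \<phi>" "b \<in> Basis \<Longrightarrow> continuous_on UNIV (pderiv_dir b (pderiv_dir b \<phi>))"
    "continuous_on UNIV (laplacian \<phi>)"
proof -
  show *: "C_k 2 \<phi>" using assms by (simp add: test_function_def smooth_def)
  show **: "continuous_on UNIV (pderiv_dir b (pderiv_dir b \<phi>))" if "b \<in> Basis" for b
    using * that by (simp add: numeral_2_eq_2)
  show "continuous_on UNIV (laplacian \<phi>)"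
    unfolding laplacian_def[abs_def] by (intro continuous_on_sum **)
qed

lemma test_function_second_derivative_bounded:
  fixes \<phi> :: "'a::euclidean_space \<Rightarrow> real"
  assumes "test_function \<phi>"
  obtains M where "M \<ge> 0" "\<And>x b. b \<in> Basis \<Longrightarrow> \<bar>pderiv_dir b (pderiv_dir b \<phi>) x\<bar> \<le> M"
proof -
  obtain r where r: "r > 0" "\<And>x. norm x > r \<Longrightarrow> \<phi> x = 0"
    using test_function_support[OF assms] by blast
  have "\<exists>M. \<forall>x. \<bar>pderiv_dir b (pderiv_dir b \<phi>) x\<bar> \<le> M" if b: "b \<in> Basis" for b
  proof -
    let ?D = "pderiv_dir b (pderiv_dir b \<phi>)"
    have "compact (?D ` cball 0 r)"
      using test_function_C2(2)[OF assms b] by (intro compact_continuous_image) (auto intro: continuous_on_subset)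
    then obtain M where M: "\<And>x. norm x \<le> r \<Longrightarrow> \<bar>?D x\<bar> \<le> M" "M > 0"
      using compact_imp_bounded[THEN bounded_pos[THEN iffD1]] by fastforce
    have "?D x = 0" if "norm x > r" for x
      by (rule pderiv_dir_zero_outside[OF pderiv_dir_zero_outside[OF r(2)] that])
    with M show ?thesis by (metis abs_zero less_imp_le not_le)
  qed
  then obtain M where M: "\<And>b x. b \<in> Basis \<Longrightarrow> \<bar>pderiv_dir b (pderiv_dir b \<phi>) x\<bar> \<le> M b" by metis
  show ?thesis
  proof (rule that[of "\<Sum>b\<in>Basis. \<bar>M b\<bar>"])
    fix x b assume b: "b \<in> (Basis :: 'a set)"
    have "\<bar>M b\<bar> \<le> (\<Sum>b\<in>Basis. \<bar>M b\<bar>)" by (rule member_le_sum) (use b in auto)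
    with M[OF b, of x] show "\<bar>pderiv_dir b (pderiv_dir b \<phi>) x\<bar> \<le> (\<Sum>b\<in>Basis. \<bar>M b\<bar>)" by linarith
  qed (auto intro: sum_nonneg)
qed

lemma dlap_eq_sum: "dlap h u x = (\<Sum>b\<in>Basis. (u (x + h *\<^sub>R b) + u (x - h *\<^sub>R b) - 2 * u x) / h\<^sup>2)"
  by (simp add: dlap_def sum_divide_distrib)

text \<open>The bound does not depend on h, so it can serve as the dominating constant when h tends
  to 0.\<close>

lemma dlap_bounded:
  fixes \<phi> :: "'a::euclidean_space \<Rightarrow> real"
  assumes "C_k 2 \<phi>" "\<And>x b. b \<in> Basis \<Longrightarrow> \<bar>pderiv_dir b (pderiv_dir b \<phi>) x\<bar> \<le> M" "h > 0"
  shows "\<bar>dlap h \<phi> x\<bar> \<le> real DIM('a) * M"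
proof -
  have "\<bar>(\<phi> (x + h *\<^sub>R b) + \<phi> (x - h *\<^sub>R b) - 2 * \<phi> x) / h\<^sup>2\<bar> \<le> M" if b: "b \<in> Basis" for b
  proof -
    obtain s t where st: "\<phi> (x + h *\<^sub>R b) + \<phi> (x - h *\<^sub>R b) - 2 * \<phi> x =
       h\<^sup>2 * ((pderiv_dir b (pderiv_dir b \<phi>) (x + s *\<^sub>R b) + pderiv_dir b (pderiv_dir b \<phi>) (x + t *\<^sub>R b)) / 2)"
      using second_difference[OF assms(1) b assms(3)] by metis
    show ?thesis
      unfolding st using assms(2)[OF b, of "x + s *\<^sub>R b"] assms(2)[OF b, of "x + t *\<^sub>R b"] assms(3)
      by simp
  qed
  then show ?thesis unfolding dlap_eq_sum
    by (intro order_trans[OF sum_abs] order_trans[OF sum_bounded_above[where K = M]]) auto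
qed

lemma dlap_tendsto_laplacian:
  fixes \<phi> :: "'a::euclidean_space \<Rightarrow> real"
  assumes "test_function \<phi>" "\<And>n. h n > 0" "h \<longlonglongrightarrow> 0"
  shows "(\<lambda>n. dlap (h n) \<phi> x) \<longlonglongrightarrow> laplacian \<phi> x"
  unfolding dlap_eq_sum laplacian_def
proof (rule tendsto_sum)
  fix b assume b: "b \<in> (Basis :: 'a set)"
  let ?D = "pderiv_dir b (pderiv_dir b \<phi>)"
  have "\<exists>s t. \<bar>s\<bar> \<le> h n \<and> \<bar>t\<bar> \<le> h n \<and> \<phi> (x + h n *\<^sub>R b) + \<phi> (x - h n *\<^sub>R b) - 2 * \<phi> x =
       (h n)\<^sup>2 * ((?D (x + s *\<^sub>R b) + ?D (x + t *\<^sub>R b)) / 2)" for n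
    using second_difference[OF test_function_C2(1)[OF assms(1)] b assms(2)[of n]] by metis
  then obtain s t where st: "\<And>n. \<bar>s n\<bar> \<le> h n" "\<And>n. \<bar>t n\<bar> \<le> h n"
    "\<And>n. \<phi> (x + h n *\<^sub>R b) + \<phi> (x - h n *\<^sub>R b) - 2 * \<phi> x =
       (h n)\<^sup>2 * ((?D (x + s n *\<^sub>R b) + ?D (x + t n *\<^sub>R b)) / 2)" by metis
  have lim: "s \<longlonglongrightarrow> 0" "t \<longlonglongrightarrow> 0"
    using st(1,2) by (auto intro!: Lim_null_comparison[OF _ assms(3)] always_eventually)
  have D: "(\<lambda>n. ?D (y n)) \<longlonglongrightarrow> ?D x" if "y \<longlonglongrightarrow> x" for y
    by (rule isCont_tendsto_compose[OF _ that])
       (use test_function_C2(2)[OF assms(1) b] in \<open>simp add: continuous_on_eq_continuous_at\<close>)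
  have "(\<lambda>n. (?D (x + s n *\<^sub>R b) + ?D (x + t n *\<^sub>R b)) / 2) \<longlonglongrightarrow> (?D x + ?D x) / 2"
    by (intro tendsto_intros D) (use lim in \<open>auto intro!: tendsto_eq_intros\<close>)
  moreover have "(\<phi> (x + h n *\<^sub>R b) + \<phi> (x - h n *\<^sub>R b) - 2 * \<phi> x) / (h n)\<^sup>2 =
      (?D (x + s n *\<^sub>R b) + ?D (x + t n *\<^sub>R b)) / 2" for n
    unfolding st(3) using assms(2)[of n] by simp
  ultimately show "(\<lambda>n. (\<phi> (x + h n *\<^sub>R b) + \<phi> (x - h n *\<^sub>R b) - 2 * \<phi> x) / (h n)\<^sup>2) \<longlonglongrightarrow> ?D x"
    by (simp only:) simp
qed

text \<open>Limiting the step to 1 gives all the difference quotients one common bounded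
  support.\<close>

lemma dlap_zero_outside:
  assumes "\<And>x. norm x > r \<Longrightarrow> u x = 0" "0 < h" "h \<le> 1" "norm x > r + 1"
  shows "dlap h u x = 0"
proof -
  have "u (x + h *\<^sub>R b) = 0 \<and> u (x - h *\<^sub>R b) = 0" if b: "b \<in> Basis" for b
  proof -
    have "norm (h *\<^sub>R b) \<le> 1" using b assms(2,3) by simp
    then show ?thesis
      using assms(1,4) norm_triangle_ineq2[of x "h *\<^sub>R b"] norm_diff_ineq[of x "h *\<^sub>R b"] by (smt (verit))
  qed
  moreover have "u x = 0" using assms(1,4) by simp
  ultimately show ?thesis by (simp add: dlap_def)
qed

lemma continuous_on_dlap: "continuous_on UNIV u \<Longrightarrow> continuous_on UNIV (dlap h u)"
  unfolding dlap_def[abs_def]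
  by (cases "h = 0") (auto intro!: continuous_intros intro: continuous_on_compose2)

lemma bounded_limit_integral:
  fixes u :: "nat \<Rightarrow> 'a::euclidean_space \<Rightarrow> real"
  assumes "\<And>n. continuous_on UNIV (u n)" "continuous_on UNIV v"
    and "\<And>x. (\<lambda>n. u n x) \<longlonglongrightarrow> v x"
    and "\<And>n x. \<bar>u n x\<bar> \<le> M" "\<And>n x. norm x > r \<Longrightarrow> u n x = 0"
  shows "(\<lambda>n. LINT x|lborel. u n x) \<longlonglongrightarrow> (LINT x|lborel. v x)"
proof (rule integral_dominated_convergence[where w = "\<lambda>x. M * indicator (cball 0 r) x"])
  show "integrable lborel (\<lambda>x::'a. M * indicator (cball 0 r) x)"
    by (intro integrable_mult_right integrable_real_indicator) (use emeasure_lborel_cball_finite in \<open>auto simp: less_top\<close>)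
  show "AE x in lborel. norm (u n x) \<le> M * indicator (cball 0 r) x" for n
    using assms(4,5) by (auto intro!: AE_I2 simp: indicator_def)
qed (use assms(1-3) in \<open>auto intro: borel_measurable_continuous_onI\<close>)

text \<open>The differences fall on the smooth \<phi>, so pointwise bounded convergence of
  \<open>u n\<close> is enough and no derivative of \<open>u n\<close> has to be controlled.
  Existence uses it with varying \<open>u n\<close>, the comparison below with a constant
  sequence.\<close>

lemma limit_integral_dlap:
  fixes u :: "nat \<Rightarrow> 'a::euclidean_space \<Rightarrow> real"
  assumes "test_function \<phi>" and "\<And>n. 0 < h n" "\<And>n. h n \<le> 1" "h \<longlonglongrightarrow> 0"
    and "\<And>n. continuous_on UNIV (u n)" "continuous_on UNIV v"
    and "\<And>x. (\<lambda>n. u n x) \<longlonglongrightarrow> v x" "\<And>n x. \<bar>u n x\<bar> \<le> M"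
  shows "(\<lambda>n. LINT x|lborel. u n x * dlap (h n) \<phi> x) \<longlonglongrightarrow> (LINT x|lborel. v x * laplacian \<phi> x)"
proof -
  obtain r where r: "r > 0" "\<And>x. norm x > r \<Longrightarrow> \<phi> x = 0"
    using test_function_support[OF assms(1)] by blast
  obtain K where K: "K \<ge> 0" "\<And>x b. b \<in> Basis \<Longrightarrow> \<bar>pderiv_dir b (pderiv_dir b \<phi>) x\<bar> \<le> K"
    using test_function_second_derivative_bounded[OF assms(1)] by blast
  show ?thesis
  proof (rule bounded_limit_integral[where M = "M * (DIM('a) * K)" and r = "r + 1"])
    show "\<bar>u n x * dlap (h n) \<phi> x\<bar> \<le> M * (DIM('a) * K)" for n x
      unfolding abs_mult
      using dlap_bounded[OF test_function_C2(1)[OF assms(1)] K(2) assms(2)[of n], of x] assms(8)[of n x]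
      by (intro mult_mono) auto
    show "u n x * dlap (h n) \<phi> x = 0" if "norm x > r + 1" for n x
      using dlap_zero_outside[OF r(2) assms(2,3) that] by simp
  qed (use assms test_function_C2 test_function_continuous in
      \<open>auto intro!: continuous_intros continuous_on_dlap tendsto_mult dlap_tendsto_laplacian\<close>)
qed

lemma lborel_integral_translate:
  fixes g :: "'a::euclidean_space \<Rightarrow> real"
  assumes "g \<in> borel_measurable borel"
  shows "(LINT x|lborel. g (x + c)) = (LINT x|lborel. g x)"
proof -
  have "(LINT x|lborel. g x) = (LINT x|distr lborel borel ((+) c). g x)"
    by (simp add: lborel_distr_plus)
  also have "\<dots> = (LINT x|lborel. g (c + x))"
    by (subst integral_distr) (use assms in auto)
  finally show ?thesis by (simp add: add.commute)
qed

text \<open>Translation invariance of Lebesgue measure moves each shift from u to \<phi> with the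
  opposite sign, and \<open>dlap\<close> is symmetric under reversing the sign of h.\<close>

lemma dlap_summation_by_parts:
  fixes u :: "'a::euclidean_space \<Rightarrow> real"
  assumes "continuous_on UNIV u" "continuous_on UNIV \<phi>" "\<And>x. norm x > r \<Longrightarrow> \<phi> x = 0"
    and h: "h \<noteq> 0"
  shows "(LINT x|lborel. dlap h u x * \<phi> x) = (LINT x|lborel. u x * dlap h \<phi> x)"
proof -
  have cu: "continuous_on UNIV (\<lambda>x. u (x + c))" for c
    using assms(1) by (intro continuous_on_compose2[OF assms(1)] continuous_intros) auto
  have cp: "continuous_on UNIV (\<lambda>x. \<phi> (x + c))" for c
    using assms(2) by (intro continuous_on_compose2[OF assms(2)] continuous_intros) auto
  have i1: "integrable lborel (\<lambda>x. u (x + c) * \<phi> x)" for c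
    by (rule integrable_continuous_bounded_support[where r = r])
       (use assms cu in \<open>auto intro!: continuous_intros\<close>)
  have i2: "integrable lborel (\<lambda>x. u x * \<phi> (x + c))" for c
  proof (rule integrable_continuous_bounded_support[where r = "r + norm c"])
    show "u x * \<phi> (x + c) = 0" if "norm x > r + norm c" for x
      using assms(3)[of "x + c"] norm_diff_ineq[of x c] that by simp
  qed (use assms cp in \<open>auto intro!: continuous_intros\<close>)
  have t: "(LINT x|lborel. u (x + c) * \<phi> x) = (LINT x|lborel. u x * \<phi> (x + - c))" for c
  proof -
    have "(\<lambda>x. u x * \<phi> (x + - c)) \<in> borel_measurable borel"
      by (intro borel_measurable_continuous_onI continuous_intros assms cp)
    from lborel_integral_translate[OF this, of c] show ?thesis by (simp add: add.assoc)
  qed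
  \<comment> \<open>The central term is written as a shift by 0, so that the same facts
    \<open>i1\<close>, \<open>t\<close> and \<open>i2\<close> cover all three terms.\<close>
  have "(LINT x|lborel. dlap h u x * \<phi> x) =
    (LINT x|lborel. (\<Sum>b\<in>Basis. (u (x + h *\<^sub>R b) * \<phi> x + u (x + - (h *\<^sub>R b)) * \<phi> x - 2 * (u (x + 0) * \<phi> x)) / h\<^sup>2))"
    unfolding dlap_eq_sum sum_distrib_right
    by (intro Bochner_Integration.integral_cong sum.cong) (simp_all add: algebra_simps diff_divide_distrib add_divide_distrib)
  also have "\<dots> = (\<Sum>b\<in>Basis. ((LINT x|lborel. u (x + h *\<^sub>R b) * \<phi> x) + (LINT x|lborel. u (x + - (h *\<^sub>R b)) * \<phi> x)
       - 2 * (LINT x|lborel. u (x + 0) * \<phi> x)) / h\<^sup>2)"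
    by (subst Bochner_Integration.integral_sum)
       (simp_all only: i1 Bochner_Integration.integrable_add Bochner_Integration.integrable_diff integrable_mult_right
          integrable_divide integral_divide_zero Bochner_Integration.integral_add Bochner_Integration.integral_diff integral_mult_right_zero)
  also have "\<dots> = (\<Sum>b\<in>Basis. ((LINT x|lborel. u x * \<phi> (x + - (h *\<^sub>R b))) + (LINT x|lborel. u x * \<phi> (x + (h *\<^sub>R b)))
       - 2 * (LINT x|lborel. u x * \<phi> (x + 0))) / h\<^sup>2)"
    unfolding t by simp
  also have "\<dots> = (LINT x|lborel. (\<Sum>b\<in>Basis. (u x * \<phi> (x + - (h *\<^sub>R b)) + u x * \<phi> (x + (h *\<^sub>R b)) - 2 * (u x * \<phi> (x + 0))) / h\<^sup>2))"
    by (subst Bochner_Integration.integral_sum)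
       (simp_all only: i2 Bochner_Integration.integrable_add Bochner_Integration.integrable_diff integrable_mult_right
          integrable_divide integral_divide_zero Bochner_Integration.integral_add Bochner_Integration.integral_diff integral_mult_right_zero)
  also have "\<dots> = (LINT x|lborel. u x * dlap h \<phi> x)"
    unfolding dlap_eq_sum sum_distrib_left
    by (intro Bochner_Integration.integral_cong sum.cong) (simp_all add: algebra_simps diff_divide_distrib add_divide_distrib)
  finally show ?thesis .
qed


section \<open>Comparison with paraboloids\<close>

lemma attains_max_minus_paraboloid:
  fixes u :: "'a::euclidean_space \<Rightarrow> real"
  assumes "continuous_on UNIV u" "\<And>x. u x \<le> M" "c > 0"
  obtains y where "\<And>x. u x - c * (norm (x - x0))\<^sup>2 \<le> u y - c * (norm (y - x0))\<^sup>2"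
proof -
  \<comment> \<open>Chosen so that beyond distance r the paraboloid has absorbed M - u x0. There the
    difference is below its value at x0, so the maximum over the compact ball is global.\<close>
  define r where "r = sqrt ((M - u x0) / c)"
  have r: "r \<ge> 0" "c * r\<^sup>2 = M - u x0"
    using assms(2)[of x0] assms(3) by (auto simp: r_def)
  have "continuous_on (cball x0 r) (\<lambda>x. u x - c * (norm (x - x0))\<^sup>2)"
    using assms(1) by (auto intro!: continuous_intros intro: continuous_on_subset)
  with r(1) obtain y where y: "\<And>x. norm (x - x0) \<le> r \<Longrightarrow> u x - c * (norm (x - x0))\<^sup>2 \<le> u y - c * (norm (y - x0))\<^sup>2"
    using continuous_attains_sup[of "cball x0 r" "\<lambda>x. u x - c * (norm (x - x0))\<^sup>2"]
    by (auto simp: dist_norm norm_minus_commute Ball_def)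
  have "u x - c * (norm (x - x0))\<^sup>2 \<le> u y - c * (norm (y - x0))\<^sup>2" if "norm (x - x0) > r" for x
  proof -
    have "c * r\<^sup>2 \<le> c * (norm (x - x0))\<^sup>2"
      using that r(1) assms(3) by (intro mult_left_mono power_mono) auto
    then show ?thesis using r(2) assms(2)[of x] y[of x0] r(1) by simp
  qed
  with y that show ?thesis by (meson not_le)
qed

text \<open>By the parallelogram law the second difference of |x - x0|^2 along a basis vector is
  exactly 2 h^2, so each direction contributes 2 c without any error in h.\<close>

lemma dlap_diff_paraboloid:
  fixes u :: "'a::euclidean_space \<Rightarrow> real"
  assumes "h \<noteq> 0"
  shows "dlap h (\<lambda>x. u x - c * (norm (x - x0))\<^sup>2) x = dlap h u x - 2 * real DIM('a) * c"
proof -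
  have sq: "(norm (x + h *\<^sub>R b - x0))\<^sup>2 + (norm (x - h *\<^sub>R b - x0))\<^sup>2 = 2 * (norm (x - x0))\<^sup>2 + 2 * h\<^sup>2"
    if b: "b \<in> Basis" for b
  proof -
    have "(x + h *\<^sub>R b - x0) = (x - x0) + h *\<^sub>R b" "(x - h *\<^sub>R b - x0) = (x - x0) - h *\<^sub>R b" by auto
    then show ?thesis using b
      by (simp only: power2_norm_eq_inner) (simp add: inner_add_left inner_add_right inner_diff_left inner_diff_right inner_commute power2_eq_square)
  qed
  have "(u (x + h *\<^sub>R b) - c * (norm (x + h *\<^sub>R b - x0))\<^sup>2 + (u (x - h *\<^sub>R b) - c * (norm (x - h *\<^sub>R b - x0))\<^sup>2) -
       2 * (u x - c * (norm (x - x0))\<^sup>2)) / h\<^sup>2 = (u (x + h *\<^sub>R b) + u (x - h *\<^sub>R b) - 2 * u x) / h\<^sup>2 - 2 * c"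
    if b: "b \<in> Basis" for b
  proof -
    have "c * (norm (x + h *\<^sub>R b - x0))\<^sup>2 + c * (norm (x - h *\<^sub>R b - x0))\<^sup>2 = 2 * (c * (norm (x - x0))\<^sup>2) + 2 * c * h\<^sup>2"
      using arg_cong[OF sq[OF b], of "(*) c"] by (simp add: algebra_simps)
    then have num: "u (x + h *\<^sub>R b) - c * (norm (x + h *\<^sub>R b - x0))\<^sup>2 + (u (x - h *\<^sub>R b) - c * (norm (x - h *\<^sub>R b - x0))\<^sup>2) -
       2 * (u x - c * (norm (x - x0))\<^sup>2) = (u (x + h *\<^sub>R b) + u (x - h *\<^sub>R b) - 2 * u x) - 2 * c * h\<^sup>2"
      by (simp add: right_diff_distrib)
    show ?thesis unfolding num using assms by (simp add: diff_divide_distrib)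
  qed
  then show ?thesis unfolding dlap_eq_sum by (simp add: sum_subtractf)
qed

lemma dlap_le_at_max:
  fixes u :: "'a::euclidean_space \<Rightarrow> real"
  assumes "\<And>x. u x - c * (norm (x - x0))\<^sup>2 \<le> u y - c * (norm (y - x0))\<^sup>2" "h \<noteq> 0"
  shows "dlap h u y \<le> 2 * real DIM('a) * c"
proof -
  let ?H = "\<lambda>x. u x - c * (norm (x - x0))\<^sup>2"
  have "?H (y + h *\<^sub>R b) + ?H (y - h *\<^sub>R b) - 2 * ?H y \<le> 0" for b
    using add_mono[OF assms(1)[of "y + h *\<^sub>R b"] assms(1)[of "y - h *\<^sub>R b"]] by simp
  then have "dlap h ?H y \<le> 0"
    unfolding dlap_def by (intro divide_nonpos_nonneg sum_nonpos) auto
  then show ?thesis by (simp add: dlap_diff_paraboloid[OF assms(2)])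
qed

text \<open>If the conclusion failed at one point, the maximum point of u minus the paraboloid would
  also lie above the paraboloid, and there the discrete Laplacian is too small. The bound d is
  requested only where u is above the paraboloid, hence, u being bounded above, only in a bounded
  region.\<close>

lemma discrete_comparison:
  fixes u :: "'a::euclidean_space \<Rightarrow> real"
  assumes "continuous_on UNIV u" "\<And>x. u x \<le> M" "c > 0" "d > 2 * real DIM('a) * c" "h \<noteq> 0"
    and "\<And>x. u x > k + c * (norm (x - x0))\<^sup>2 \<Longrightarrow> dlap h u x \<ge> d"
  shows "u x \<le> k + c * (norm (x - x0))\<^sup>2"
proof (rule ccontr)
  assume *: "\<not> ?thesis"
  obtain y where y: "\<And>x. u x - c * (norm (x - x0))\<^sup>2 \<le> u y - c * (norm (y - x0))\<^sup>2"
    using attains_max_minus_paraboloid[OF assms(1-3)] by blast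
  have "u y > k + c * (norm (y - x0))\<^sup>2" using * y[of x] by linarith
  from assms(6)[OF this] dlap_le_at_max[OF y assms(5)] assms(4) show False by linarith
qed

section \<open>Mollification and the comparison for distributional Laplacians\<close>

lemma integral_ge_const_mult:
  fixes G :: "'a::euclidean_space \<Rightarrow> real"
  assumes "continuous_on UNIV G" "continuous_on UNIV \<phi>" "\<And>x. norm x > r \<Longrightarrow> \<phi> x = 0"
    and "\<And>x. \<phi> x \<ge> 0" "\<And>x. \<phi> x > 0 \<Longrightarrow> a \<le> G x"
  shows "a * (LINT x|lborel. \<phi> x) \<le> (LINT x|lborel. G x * \<phi> x)"
proof -
  have "(LINT x|lborel. a * \<phi> x) \<le> (LINT x|lborel. G x * \<phi> x)"
  proof (rule integral_mono)
    show "a * \<phi> x \<le> G x * \<phi> x" for x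
      using assms(4,5)[of x] by (cases "\<phi> x = 0") (auto intro!: mult_right_mono)
  qed (rule integrable_continuous_bounded_support[where r = r]; use assms in \<open>auto intro!: continuous_intros\<close>)+
  then show ?thesis by simp
qed

lemma continuous_on_translate:
  fixes u :: "'a::euclidean_space \<Rightarrow> real"
  assumes "continuous_on UNIV u"
  shows "continuous_on UNIV (\<lambda>x. u (x + c))"
  by (rule continuous_on_compose2[OF assms]) (auto intro!: continuous_intros)

text \<open>The variable y is placed in u and not in \<phi>, so that differences in y act on u under
  the integral. Continuity is what allows the mollified function minus a paraboloid to attain its
  maximum.\<close>

lemma continuous_on_mollification:
  fixes u :: "'a::euclidean_space \<Rightarrow> real"
  assumes "continuous_on UNIV u" "\<And>x. \<bar>u x\<bar> \<le> M"
    and "continuous_on UNIV \<phi>" "\<And>x. norm x > r \<Longrightarrow> \<phi> x = 0" "\<And>x. \<bar>\<phi> x\<bar> \<le> K"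
  shows "continuous_on UNIV (\<lambda>y. LINT x|lborel. u (x + y) * \<phi> x)"
proof (rule continuous_at_imp_continuous_on, rule ballI)
  fix y
  show "isCont (\<lambda>y. LINT x|lborel. u (x + y) * \<phi> x) y"
    unfolding continuous_at_sequentially comp_def
  proof (intro allI impI)
    fix Y assume Y: "Y \<longlonglongrightarrow> y"
    show "(\<lambda>n. LINT x|lborel. u (x + Y n) * \<phi> x) \<longlonglongrightarrow> (LINT x|lborel. u (x + y) * \<phi> x)"
    proof (rule bounded_limit_integral[where M = "M * K" and r = r])
      show "(\<lambda>n. u (x + Y n) * \<phi> x) \<longlonglongrightarrow> u (x + y) * \<phi> x" for x
      proof (intro tendsto_intros isCont_tendsto_compose[where g = u])
        show "isCont u (x + y)" using assms(1) by (simp add: continuous_on_eq_continuous_at)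
      qed (rule Y)
      show "\<bar>u (x + Y n) * \<phi> x\<bar> \<le> M * K" for n x
        unfolding abs_mult using assms(2)[of "x + Y n"] assms(5)[of x] by (intro mult_mono) auto
    qed (use assms in \<open>auto intro!: continuous_intros continuous_on_translate\<close>)
  qed
qed

lemma dlap_mollification:
  fixes u :: "'a::euclidean_space \<Rightarrow> real"
  assumes "continuous_on UNIV u"
    and "continuous_on UNIV \<phi>" "\<And>x. norm x > r \<Longrightarrow> \<phi> x = 0"
  shows "dlap h (\<lambda>y. LINT x|lborel. u (x + y) * \<phi> x) y = (LINT x|lborel. dlap h u (x + y) * \<phi> x)"
proof -
  have i: "integrable lborel (\<lambda>x. u (x + c) * \<phi> x)" for c
    by (rule integrable_continuous_bounded_support[where r = r])
       (use assms continuous_on_translate in \<open>auto intro!: continuous_intros\<close>)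
  have "(LINT x|lborel. dlap h u (x + y) * \<phi> x) =
    (LINT x|lborel. (\<Sum>b\<in>Basis. (u (x + (y + h *\<^sub>R b)) * \<phi> x + u (x + (y - h *\<^sub>R b)) * \<phi> x - 2 * (u (x + y) * \<phi> x)) / h\<^sup>2))"
    unfolding dlap_eq_sum sum_distrib_right
    by (intro Bochner_Integration.integral_cong sum.cong) (simp_all add: algebra_simps diff_divide_distrib add_divide_distrib)
  also have "\<dots> = (\<Sum>b\<in>Basis. ((LINT x|lborel. u (x + (y + h *\<^sub>R b)) * \<phi> x) + (LINT x|lborel. u (x + (y - h *\<^sub>R b)) * \<phi> x)
       - 2 * (LINT x|lborel. u (x + y) * \<phi> x)) / h\<^sup>2)"
    by (subst Bochner_Integration.integral_sum)
       (simp_all only: i Bochner_Integration.integrable_add Bochner_Integration.integrable_diff integrable_mult_right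
          integrable_divide integral_divide_zero Bochner_Integration.integral_add Bochner_Integration.integral_diff integral_mult_right_zero)
  finally show ?thesis by (simp add: dlap_eq_sum)
qed

lemma bump_le_1: "bump c r x \<le> 1"
  by (simp add: bump_def flat_def)

lemma integral_bump_pos:
  assumes "r > 0"
  shows "(LINT x|lborel. bump (c::'a::euclidean_space) r x) > 0"
proof -
  have t: "test_function (\<lambda>x. 1 * bump c r x)" by (rule test_function_scaled_bump) fact
  \<comment> \<open>The value of the bump at distance r/2 from its centre, hence a lower bound for
    it on the ball of half the radius.\<close>
  define k where "k = exp (- 1 / (r\<^sup>2 - (r/2)\<^sup>2))"
  have r2: "(r/2)\<^sup>2 < r\<^sup>2" using assms by (intro power_strict_mono) auto
  have "0 < k * measure lborel (ball c (r/2))"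
    using assms by (simp add: k_def content_ball_pos)
  also have "\<dots> = (LINT x|lborel. k * indicator (ball c (r/2)) x)"
    by simp
  also have "\<dots> \<le> (LINT x|lborel. bump c r x)"
  proof (rule integral_mono)
    show "integrable lborel (\<lambda>x. k * indicator (ball c (r/2)) x :: real)"
      by (intro integrable_mult_right integrable_real_indicator)
         (use emeasure_lborel_ball_finite in \<open>auto simp: less_top\<close>)
    obtain s where s: "\<And>x. norm x > s \<Longrightarrow> 1 * bump c r x = 0" using test_function_support[OF t] by blast
    show "integrable lborel (bump c r)"
      by (rule integrable_continuous_bounded_support[where r = s]) (use test_function_continuous[OF t] s in auto)
    show "k * indicator (ball c (r/2)) x \<le> bump c r x" for x
    proof (cases "x \<in> ball c (r/2)")
      case True
      then have "norm (x - c) < r/2" by (simp add: dist_norm norm_minus_commute)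
      then have *: "(norm (x - c))\<^sup>2 < (r/2)\<^sup>2" by (intro power_strict_mono) auto
      then have "1 / (r\<^sup>2 - (norm (x - c))\<^sup>2) \<le> 1 / (r\<^sup>2 - (r/2)\<^sup>2)"
        using r2 by (intro divide_left_mono mult_pos_pos) auto
      then show ?thesis using * r2 True by (simp add: k_def bump_def flat_def)
    qed (simp add: bump_nonneg)
  qed
  finally show ?thesis .
qed

text \<open>One factor serves all centres by translation invariance. This matters because the
  mollifier will be centred at a maximum point that is found only after mollifying.\<close>

lemma normalised_bump:
  assumes "r > 0"
  obtains \<kappa> where "\<kappa> > 0" "\<And>c::'a::euclidean_space. (LINT x|lborel. \<kappa> * bump c r x) = 1"
proof -
  have m: "bump 0 r \<in> borel_measurable borel" for r :: real
    unfolding bump_def[abs_def] flat_def by measurable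
  have "(LINT x|lborel. bump c r x) = (LINT x|lborel. bump (0::'a) r x)" for c :: 'a
    using lborel_integral_translate[OF m, of r "- c"] by (subst bump_translate) simp
  then have eq: "(LINT x|lborel. k * bump c r x) = k * (LINT x|lborel. bump (0::'a) r x)" for c :: 'a and k
    by (metis integral_mult_right_zero)
  have "(LINT x|lborel. bump (0::'a) r x) > 0" by (rule integral_bump_pos) fact
  then show ?thesis
    by (intro that[of "1 / (LINT x|lborel. bump (0::'a) r x)"]) (simp, subst eq, simp)
qed

text \<open>The mollified \<open>u\<close> minus the paraboloid attains its maximum at some \<open>y\<close>, where its second
  differences are at most those of the paraboloid. By duality this bounds the pairing of the
  distributional Laplacian of \<open>u\<close> with the mollifier centred at \<open>y\<close>, on whose support \<open>u\<close> still
  exceeds the paraboloid.\<close>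

lemma distributional_comparison:
  fixes u :: "'a::euclidean_space \<Rightarrow> real"
  assumes u: "continuous_on UNIV u" "\<And>x. \<bar>u x\<bar> \<le> M" and g: "continuous_on UNIV g"
    and eq: "\<And>\<phi>. test_function \<phi> \<Longrightarrow> (LINT x|lborel. u x * laplacian \<phi> x) = (LINT x|lborel. g x * \<phi> x)"
    and c: "c > 0" and d: "d > 2 * real DIM('a) * c"
    and above: "\<And>x. u x > k + c * (norm (x - x0))\<^sup>2 \<Longrightarrow> g x \<ge> d"
  shows "u x \<le> k + c * (norm (x - x0))\<^sup>2"
proof (rule ccontr)
  assume *: "\<not> ?thesis"
  define V where "V x = u x - c * (norm (x - x0))\<^sup>2" for x
  \<comment> \<open>The excess over the paraboloid at x. Mollifying costs m/4 at x and m/4 at the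
    maximum point y, and moving from y to a point of the mollifier's support costs less than m/4, so
    a positive excess remains there.\<close>
  define m where "m = V x - k"
  have m: "m > 0" using * by (simp add: m_def V_def)
  have M: "M \<ge> 0" using u(2)[of x] by linarith
  \<comment> \<open>Since the mollified function W also has absolute value at most M, comparing its
    values at x and at the maximum point y gives c|y - x0|^2 \<le> 2 M + c|x - x0|^2, which is c
    r^2.\<close>
  define r where "r = sqrt (2 * M / c + (norm (x - x0))\<^sup>2)"
  have "2 * M / c + (norm (x - x0))\<^sup>2 \<ge> 0" using M c by simp
  then have r: "r \<ge> 0" "c * r\<^sup>2 = 2 * M + c * (norm (x - x0))\<^sup>2"
    using c by (simp_all add: r_def distrib_left)
  have in_ball: "norm (z - x0) \<le> r" if "c * (norm (z - x0))\<^sup>2 \<le> c * r\<^sup>2" for z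
    by (rule power2_le_imp_le[OF _ r(1)]) (rule mult_left_le_imp_le[OF that c])
  have Vc: "continuous_on UNIV V"
    unfolding V_def[abs_def] using u(1) by (intro continuous_intros)
  \<comment> \<open>The ball is enlarged by 1 to hold the mollifier's support. The modulus of V
    controls the passage from y to nearby points, that of u the error of mollification.\<close>
  have V: "uniformly_continuous_on (cball x0 (r + 1)) V"
    by (rule compact_uniformly_continuous[OF continuous_on_subset[OF Vc]]) auto
  have U: "uniformly_continuous_on (cball x0 (r + 1)) u"
    by (rule compact_uniformly_continuous[OF continuous_on_subset[OF u(1)]]) auto
  have m4: "m / 4 > 0" using m by simp
  obtain e1 where e1: "e1 > 0" "\<And>x y. x \<in> cball x0 (r + 1) \<Longrightarrow> y \<in> cball x0 (r + 1) \<Longrightarrow> dist y x < e1 \<Longrightarrow> dist (V y) (V x) < m / 4"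
    by (rule uniformly_continuous_onE[OF V m4]) (rule that)
  obtain e2 where e2: "e2 > 0" "\<And>x y. x \<in> cball x0 (r + 1) \<Longrightarrow> y \<in> cball x0 (r + 1) \<Longrightarrow> dist y x < e2 \<Longrightarrow> dist (u y) (u x) < m / 4"
    by (rule uniformly_continuous_onE[OF U m4]) (rule that)
  define e where "e = min 1 (min e1 e2)"
  have e0: "e > 0" "e \<le> 1" "e \<le> e1" "e \<le> e2" using e1(1) e2(1) by (auto simp: e_def)
  have close: "\<bar>V y - V z\<bar> < m / 4" "\<bar>u y - u z\<bar> < m / 4" if "norm (z - x0) \<le> r" "norm (y - z) < e" for y z
  proof -
    have "norm (y - x0) \<le> r + 1" using norm_triangle_ineq[of "y - z" "z - x0"] that e0(2) by simp
    then have "y \<in> cball x0 (r + 1)" "z \<in> cball x0 (r + 1)"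
      using that by (auto simp: dist_norm norm_minus_commute)
    then show "\<bar>V y - V z\<bar> < m / 4" "\<bar>u y - u z\<bar> < m / 4"
      using e1(2)[of z y] e2(2)[of z y] that(2) e0 by (auto simp: dist_norm)
  qed
  obtain \<kappa> where \<kappa>: "\<kappa> > 0" "\<And>c::'a. (LINT x|lborel. \<kappa> * bump c e x) = 1"
    using normalised_bump[OF e0(1)] by blast
  define \<phi> where "\<phi> = (\<lambda>(c::'a) x. \<kappa> * bump c e x)"
  have \<phi>: "test_function (\<phi> c)" "\<phi> c x \<ge> 0" "\<phi> c x \<le> \<kappa>" "\<phi> c x > 0 \<longleftrightarrow> norm (x - c) < e"
    "(LINT x|lborel. \<phi> c x) = 1" "\<phi> c (x + c) = \<phi> 0 x" for c x
    unfolding \<phi>_def using \<kappa>(1) e0(1) bump_pos_iff[OF e0(1), of c x]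
    by (auto simp: bump_nonneg bump_le_1 zero_less_mult_iff \<kappa>(2) simp del: integral_mult_right_zero
        intro: test_function_scaled_bump) (simp_all add: bump_def)
  have \<phi>c: "continuous_on UNIV (\<phi> c)" for c by (rule test_function_continuous[OF \<phi>(1)])
  have \<phi>0: "\<phi> 0 x = 0" if "norm x > e" for x
    using \<phi>(2)[of 0 x] \<phi>(4)[of 0 x] that by auto
  define W where "W y = (LINT x|lborel. u (x + y) * \<phi> 0 x)" for y
  have avg: "a \<le> W y" if "\<And>z. norm z < e \<Longrightarrow> a \<le> u (z + y)" for a y
    using integral_ge_const_mult[where r = e and a = a, OF continuous_on_translate[OF u(1), of y] \<phi>c \<phi>0 \<phi>(2)] that \<phi>(4)[of 0] \<phi>(5)[of 0]
    by (simp add: W_def)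
  have avg': "W y \<le> a" if "\<And>z. norm z < e \<Longrightarrow> u (z + y) \<le> a" for a y
    using integral_ge_const_mult[where r = e and a = "-a", OF continuous_on_minus[OF continuous_on_translate[OF u(1), of y]] \<phi>c \<phi>0 \<phi>(2)] that \<phi>(4)[of 0] \<phi>(5)[of 0]
    by (simp add: W_def)
  have Wb: "\<bar>W y\<bar> \<le> M" for y
    using avg[of "-M" y] avg'[of y M] u(2) by (smt (verit, ccfv_SIG))
  have Wc: "continuous_on UNIV W"
    unfolding W_def[abs_def]
    by (rule continuous_on_mollification[where r = e and K = \<kappa>, OF u \<phi>c \<phi>0]) (use \<phi>(2,3) in \<open>auto simp: abs_le_iff intro: order_trans\<close>)
  have Wu: "\<bar>W y - u y\<bar> \<le> m / 4" if "norm (y - x0) \<le> r" for y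
  proof -
    have near: "\<bar>u (z + y) - u y\<bar> < m / 4" if "norm z < e" for z
      using close(2)[of y "z + y"] that \<open>norm (y - x0) \<le> r\<close> by simp
    have "u y - m / 4 \<le> W y"
    proof (rule avg)
      show "u y - m / 4 \<le> u (z + y)" if "norm z < e" for z using near[OF that] by linarith
    qed
    moreover have "W y \<le> u y + m / 4"
    proof (rule avg')
      show "u (z + y) \<le> u y + m / 4" if "norm z < e" for z using near[OF that] by linarith
    qed
    ultimately show ?thesis by linarith
  qed
  obtain y where y: "\<And>x. W x - c * (norm (x - x0))\<^sup>2 \<le> W y - c * (norm (y - x0))\<^sup>2"
    using attains_max_minus_paraboloid[OF Wc _ c, of M] Wb by (metis abs_le_D1)
  have "norm (y - x0) \<le> r"
    using y[of x] Wb[of x] Wb[of y] r(2) by (intro in_ball) linarith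
  moreover have "norm (x - x0) \<le> r"
    using r(2) M by (intro in_ball) linarith
  ultimately have Vy: "V y \<ge> V x - m / 2"
    using Wu[of x] Wu[of y] y[of x] unfolding V_def abs_le_iff by argo
  have gd: "g z \<ge> d" if "\<phi> y z > 0" for z
  proof (rule above)
    have "V z > V y - m / 4"
      using close(1)[of y z, OF \<open>norm (y - x0) \<le> r\<close>] that \<phi>(4)[of y z] by linarith
    then have "V z > k" using Vy m unfolding m_def by argo
    then show "k + c * (norm (z - x0))\<^sup>2 < u z" by (simp add: V_def)
  qed
  obtain s where s: "s > 0" "\<And>x. norm x > s \<Longrightarrow> \<phi> y x = 0"
    using test_function_support[OF \<phi>(1)] by blast
  have "d \<le> (LINT x|lborel. g x * \<phi> y x)"
    using integral_ge_const_mult[OF g \<phi>c s(2) \<phi>(2) gd] \<phi>(5)[of y] by simp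
  then have lower: "d \<le> (LINT x|lborel. u x * laplacian (\<phi> y) x)"
    using eq[OF \<phi>(1)] by simp
  define h where "h n = inverse (real (Suc n))" for n
  have h: "h n > 0" "h n \<le> 1" "h \<longlonglongrightarrow> 0" for n
    using LIMSEQ_inverse_real_of_nat by (auto simp: h_def[abs_def] inverse_le_1_iff)
  have "(LINT x|lborel. u x * dlap (h n) (\<phi> y) x) \<le> 2 * real DIM('a) * c" for n
  proof -
    have "(LINT x|lborel. u x * dlap (h n) (\<phi> y) x) = (LINT x|lborel. dlap (h n) u x * \<phi> y x)"
      using h(1)[of n] by (intro dlap_summation_by_parts[symmetric] u \<phi>c) (use s in auto)
    \<comment> \<open>Translating by y moves the mollifier back to the origin, so the pairing
      becomes a second difference of W at its maximum point.\<close>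
    also have "\<dots> = (LINT x|lborel. dlap (h n) u (x + y) * \<phi> y (x + y))"
      by (intro lborel_integral_translate[symmetric] borel_measurable_continuous_onI continuous_intros continuous_on_dlap u \<phi>c)
    also have "\<dots> = dlap (h n) W y"
      unfolding W_def[abs_def] \<phi>(6) by (rule dlap_mollification[OF u(1) \<phi>c \<phi>0, symmetric])
    also have "\<dots> \<le> 2 * real DIM('a) * c"
      by (rule dlap_le_at_max[OF y]) (use h(1)[of n] in auto)
    finally show ?thesis .
  qed
  moreover have "(\<lambda>n. LINT x|lborel. u x * dlap (h n) (\<phi> y) x) \<longlonglongrightarrow> (LINT x|lborel. u x * laplacian (\<phi> y) x)"
    by (rule limit_integral_dlap[OF \<phi>(1) h]) (use u in auto)
  ultimately have "(LINT x|lborel. u x * laplacian (\<phi> y) x) \<le> 2 * real DIM('a) * c"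
    by (intro LIMSEQ_le_const2) auto
  with lower d show False by linarith
qed


section \<open>Existence, uniqueness and the singular limit\<close>

text \<open>The setting of the truncated equation, with \<alpha> in the role of
  \<open>a\<^sup>2\<close>. The bound \<open>\<alpha> \<ge> L + 1\<close> gives the margin in every
  comparison. The bound on F keeps solutions of the discrete equation and roots of the limiting
  equation in \<open>[-R, R]\<close>.\<close>

locale absorption =
  fixes F :: "real \<Rightarrow> real" and L \<alpha> R :: real and q :: "'a::euclidean_space \<Rightarrow> real"
  assumes F_lipschitz: "\<And>s t. \<bar>F s - F t\<bar> \<le> L * \<bar>s - t\<bar>"
    and F_bounded: "\<And>s. \<bar>F s\<bar> \<le> \<alpha> * R"
    and L_nonneg: "L \<ge> 0" and \<alpha>_ge: "\<alpha> \<ge> L + 1" and R_pos: "R > 0"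
    and q_continuous: "continuous_on UNIV q" and q_ge: "\<And>x. q x \<ge> \<alpha>"
begin

text \<open>The equation is solved for the Laplacian, the form in which
  \<open>distributional_comparison\<close> takes it.\<close>

definition weak_solution :: "real \<Rightarrow> ('a \<Rightarrow> real) \<Rightarrow> bool" where
  "weak_solution \<epsilon> u \<longleftrightarrow> continuous_on UNIV u \<and> (\<forall>x. \<bar>u x\<bar> \<le> R) \<and>
     (\<forall>\<phi>. test_function \<phi> \<longrightarrow>
       (LINT x|lborel. u x * laplacian \<phi> x) = (LINT x|lborel. (q x * u x - F (u x)) / \<epsilon>\<^sup>2 * \<phi> x))"

lemma F_continuous: "continuous_on UNIV F"
proof (rule continuous_at_imp_continuous_on, rule ballI)
  fix s
  have "((\<lambda>t. F t - F s) \<longlongrightarrow> 0) (at s)"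
  proof (rule Lim_null_comparison)
    show "\<forall>\<^sub>F t in at s. norm (F t - F s) \<le> L * \<bar>t - s\<bar>" using F_lipschitz by simp
    show "((\<lambda>t. L * \<bar>t - s\<bar>) \<longlongrightarrow> 0) (at s)" by (auto intro!: tendsto_eq_intros)
  qed
  then show "isCont F s" unfolding isCont_def by (rule LIM_zero_cancel)
qed

lemma continuous_on_F: "continuous_on UNIV u \<Longrightarrow> continuous_on UNIV (\<lambda>x. F (u x))"
  by (rule continuous_on_compose2[OF F_continuous]) auto

text \<open>Of the L + 1 copies of w supplied by k, the nonlinearity consumes L and one is left. It
  is applied with k = q x.\<close>

lemma zeroth_order_lower_bound:
  assumes "w > 0" "\<bar>F s - F t\<bar> \<le> L * w" "k \<ge> \<alpha>"
  shows "k * w - \<bar>F s - F t\<bar> \<ge> w"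
proof -
  have "(L + 1) * w \<le> k * w" using assms(1,3) \<alpha>_ge by (intro mult_right_mono) auto
  then show ?thesis using assms(2) by (simp add: distrib_right)
qed

section \<open>Existence\<close>

text \<open>Solving the discrete equation for its central value gives a fixed-point problem in which
  q appears only in a denominator, so an unbounded q does no harm. The contraction factor (D + L) /
  (D + \<alpha>) is below 1 for every h, though it tends to 1 as h tends to 0.\<close>

lemma discrete_solution:
  assumes "\<epsilon> > 0" "h > 0"
  shows "\<exists>u. continuous_on UNIV u \<and> (\<forall>x. \<bar>u x\<bar> \<le> R) \<and> (\<forall>x. \<epsilon>\<^sup>2 * dlap h u x = q x * u x - F (u x))"
proof -
  \<comment> \<open>N is the weight of each neighbour after multiplication by
    \<open>\<epsilon>\<^sup>2\<close>; D is the total weight of the neighbours, which reappears as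
    the coefficient of the central value.\<close>
  define N where "N = \<epsilon>\<^sup>2 / h\<^sup>2"
  define D where "D = 2 * real DIM('a) * N"
  have N: "N > 0" "D > 0" using assms by (simp_all add: N_def D_def)
  have \<alpha>: "\<alpha> > 0" using L_nonneg \<alpha>_ge by simp
  define S where "S u x = (\<Sum>b\<in>Basis. u (x + h *\<^sub>R b) + u (x - h *\<^sub>R b))" for u :: "'a \<Rightarrow> real" and x
  have S_le: "N * \<bar>S u x\<bar> \<le> D * B" if "\<And>x. \<bar>u x\<bar> \<le> B" for u B x
  proof -
    have "\<bar>S u x\<bar> \<le> (\<Sum>b\<in>(Basis::'a set). 2 * B)"
      unfolding S_def
    proof (rule order_trans[OF sum_abs sum_mono])
      show "\<bar>u (x + h *\<^sub>R b) + u (x - h *\<^sub>R b)\<bar> \<le> 2 * B" for b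
        using that[of "x + h *\<^sub>R b"] that[of "x - h *\<^sub>R b"] by linarith
    qed
    then have "N * \<bar>S u x\<bar> \<le> N * (2 * real DIM('a) * B)"
      using N(1) by (intro mult_left_mono) auto
    then show ?thesis by (simp add: D_def mult_ac)
  qed
  have S_diff: "S u x - S v x = S (\<lambda>x. u x - v x) x" for u v x
    unfolding S_def sum_subtractf[symmetric] by (intro sum.cong) auto
  define T where "T u x = (N * S u x + F (u x)) / (D + q x)" for u x
  have Dq: "D + q x \<ge> D + \<alpha>" "D + q x > 0" for x using q_ge[of x] N(2) \<alpha> by linarith+
  have T_le: "\<bar>T u x\<bar> \<le> (D * B + \<alpha> * R) / (D + \<alpha>)" if "\<And>x. \<bar>u x\<bar> \<le> B" for u B x
  proof -
    have "\<bar>N * S u x + F (u x)\<bar> \<le> D * B + \<alpha> * R"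
      using S_le[where u = u and B = B and x = x, OF that] F_bounded[of "u x"] N(1) abs_triangle_ineq[of "N * S u x" "F (u x)"]
      by (simp add: abs_mult)
    then have "\<bar>T u x\<bar> \<le> (D * B + \<alpha> * R) / (D + q x)"
      unfolding T_def abs_divide using Dq(2)[of x] by (simp add: divide_right_mono)
    also have "\<dots> \<le> (D * B + \<alpha> * R) / (D + \<alpha>)"
      using Dq[of x] N(2) \<alpha> R_pos that[of x] by (intro divide_left_mono mult_pos_pos add_nonneg_nonneg mult_nonneg_nonneg) auto
    finally show ?thesis .
  qed
  have T_cont: "continuous_on UNIV (T u)" if u: "continuous_on UNIV u" for u
  proof -
    have "continuous_on UNIV (\<lambda>x. u (x + c))" "continuous_on UNIV (\<lambda>x. u (x - c))" for c
      by (rule continuous_on_compose2[OF u]; auto intro!: continuous_intros)+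
    then show ?thesis
      unfolding T_def[abs_def] S_def
      using continuous_on_F[OF u] q_continuous Dq(2) by (intro continuous_intros) (auto simp: less_imp_neq[symmetric])
  qed
  have T_bcontfun: "T (apply_bcontfun u) \<in> bcontfun" for u :: "'a \<Rightarrow>\<^sub>C real"
  proof (rule bcontfun_normI)
    show "norm (T (apply_bcontfun u) x) \<le> (D * norm u + \<alpha> * R) / (D + \<alpha>)" for x
      using T_le[of "apply_bcontfun u" "norm u" x] norm_bounded[of u] by simp
  qed (rule T_cont, simp)
  define \<Phi> where "\<Phi> u = Bcontfun (T (apply_bcontfun u))" for u :: "'a \<Rightarrow>\<^sub>C real"
  have \<Phi>: "apply_bcontfun (\<Phi> u) = T (apply_bcontfun u)" for u
    unfolding \<Phi>_def using T_bcontfun by (rule Bcontfun_inverse)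
  have "\<exists>!u. \<Phi> u = u"
  proof (rule banach_fix_type)
    show "0 \<le> (D + L) / (D + \<alpha>)" "(D + L) / (D + \<alpha>) < 1"
      using N(2) \<alpha> \<alpha>_ge L_nonneg by auto
    show "\<forall>u v. dist (\<Phi> u) (\<Phi> v) \<le> (D + L) / (D + \<alpha>) * dist u v"
    proof (intro allI dist_bound)
      fix u v :: "'a \<Rightarrow>\<^sub>C real" and x
      let ?u = "apply_bcontfun u" and ?v = "apply_bcontfun v"
      have d: "\<bar>?u x - ?v x\<bar> \<le> dist u v" for x using dist_bounded[of u _ v] unfolding dist_real_def by blast
      have "\<bar>F (?u x) - F (?v x)\<bar> \<le> L * dist u v"
        using F_lipschitz[of "?u x" "?v x"] mult_left_mono[OF d[of x] L_nonneg] by linarith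
      moreover have "\<bar>N * (S ?u x - S ?v x)\<bar> \<le> D * dist u v"
        unfolding S_diff using S_le[where u = "\<lambda>x. ?u x - ?v x" and B = "dist u v" and x = x, OF d] N(1) by (simp add: abs_mult)
      ultimately have "\<bar>(N * S ?u x + F (?u x)) - (N * S ?v x + F (?v x))\<bar> \<le> (D + L) * dist u v"
        unfolding right_diff_distrib distrib_right by linarith
      then have "\<bar>T ?u x - T ?v x\<bar> \<le> (D + L) * dist u v / (D + q x)"
        unfolding T_def diff_divide_distrib[symmetric] abs_divide using Dq(2)[of x] by (simp add: divide_right_mono)
      also have "\<dots> \<le> (D + L) * dist u v / (D + \<alpha>)"
        using Dq[of x] N(2) \<alpha> L_nonneg by (intro divide_left_mono mult_pos_pos mult_nonneg_nonneg) auto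
      finally show "dist (apply_bcontfun (\<Phi> u) x) (apply_bcontfun (\<Phi> v) x) \<le> (D + L) / (D + \<alpha>) * dist u v"
        by (simp add: \<Phi> dist_real_def)
    qed
  qed
  then obtain U where U: "\<Phi> U = U" by blast
  define u where "u = apply_bcontfun U"
  have u: "T u = u" using \<Phi>[of U] U by (simp add: u_def)
  have uc: "continuous_on UNIV u" by (simp add: u_def)
  \<comment> \<open>\<open>T_le\<close> is applied to the fixed point with its own norm as B. The
    terms with D cancel, which leaves the bound R whatever h is.\<close>
  have "norm U \<le> (D * norm U + \<alpha> * R) / (D + \<alpha>)"
    by (rule norm_bound) (use T_le[of u "norm U"] norm_bounded[of U] u in \<open>simp add: u_def\<close>)
  then have "norm U \<le> R"
    using N(2) \<alpha> by (simp add: field_simps)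
  then have uR: "\<bar>u x\<bar> \<le> R" for x
    using order_trans[OF norm_bounded[of U x]] by (simp add: u_def)
  have "\<epsilon>\<^sup>2 * dlap h u x = q x * u x - F (u x)" for x
  proof -
    have "(D + q x) * u x = N * S u x + F (u x)"
      using arg_cong[OF fun_cong[OF u, of x], of "(*) (D + q x)"] Dq(2)[of x] by (simp add: T_def)
    moreover have "dlap h u x = (S u x - 2 * real DIM('a) * u x) / h\<^sup>2"
      unfolding dlap_def S_def sum_subtractf by simp
    then have "\<epsilon>\<^sup>2 * dlap h u x = N * S u x - D * u x"
      by (simp add: N_def D_def right_diff_distrib diff_divide_distrib)
    ultimately show ?thesis by (simp add: distrib_right)
  qed
  with uc uR show ?thesis by blast
qed

text \<open>The increment w of u under a shift by z solves the equation with the extra source (q(x +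
  z) - q x) u(x + z). Where w exceeds \<tau> plus the paraboloid, the zeroth-order part is above
  \<tau> and the source takes at most \<tau>/2. Nothing here depends on h, so s is chosen before h
  and u.\<close>

lemma discrete_solutions_equicontinuous:
  assumes "\<epsilon> > 0" "\<tau> > 0"
  shows "\<exists>s>0. \<forall>h>0. \<forall>u. continuous_on UNIV u \<and> (\<forall>x. \<bar>u x\<bar> \<le> R) \<and> (\<forall>x. \<epsilon>\<^sup>2 * dlap h u x = q x * u x - F (u x))
     \<longrightarrow> (\<forall>z. norm z < s \<longrightarrow> \<bar>u (x1 + z) - u x1\<bar> \<le> \<tau>)"
proof -
  \<comment> \<open>The remaining \<tau>/2, divided by \<open>\<epsilon>\<^sup>2\<close>; c then
    makes the Laplacian of the paraboloid equal to d/2.\<close>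
  define d where "d = \<tau> / (2 * \<epsilon>\<^sup>2)"
  define c where "c = d / (4 * real DIM('a))"
  have d: "d > 0" using assms by (simp add: d_def)
  have c: "c > 0" "d > 2 * real DIM('a) * c" using d by (simp_all add: c_def)
  \<comment> \<open>Increments are at most 2 R, so beyond distance \<rho> from x1 none of them is
    above the paraboloid. Continuity of q is needed only near that ball.\<close>
  define \<rho> where "\<rho> = sqrt (2 * R / c)"
  have \<rho>: "\<rho> \<ge> 0" "c * \<rho>\<^sup>2 = 2 * R" using c R_pos by (simp_all add: \<rho>_def)
  have "uniformly_continuous_on (cball x1 (\<rho> + 1)) q"
    by (rule compact_uniformly_continuous[OF continuous_on_subset[OF q_continuous]]) auto
  moreover have "\<tau> / (2 * R) > 0" using assms R_pos by simp
  ultimately obtain s0 where s0: "s0 > 0" "\<And>x y. x \<in> cball x1 (\<rho> + 1) \<Longrightarrow> y \<in> cball x1 (\<rho> + 1) \<Longrightarrow> dist y x < s0 \<Longrightarrow> dist (q y) (q x) < \<tau> / (2 * R)"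
    by (rule uniformly_continuous_onE) (rule that)
  show ?thesis
  proof (intro exI[of _ "min 1 s0"] conjI allI impI)
    show "min 1 s0 > 0" using s0 by simp
    fix h :: real and u :: "'a \<Rightarrow> real" and z :: 'a assume h: "h > 0" and z: "norm z < min 1 s0"
      and "continuous_on UNIV u \<and> (\<forall>x. \<bar>u x\<bar> \<le> R) \<and> (\<forall>x. \<epsilon>\<^sup>2 * dlap h u x = q x * u x - F (u x))"
    then have u: "continuous_on UNIV u" "\<And>x. \<bar>u x\<bar> \<le> R" "\<And>x. \<epsilon>\<^sup>2 * dlap h u x = q x * u x - F (u x)" by auto
    \<comment> \<open>The sign \<sigma> treats the upper and the lower bound in one
      argument.\<close>
    have one_sided: "\<sigma> * (u (x1 + z) - u x1) \<le> \<tau>" if \<sigma>: "\<sigma> = 1 \<or> \<sigma> = -1" for \<sigma> :: real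
    proof -
      define w where "w x = \<sigma> * (u (x + z) - u x)" for x
      have wc: "continuous_on UNIV w"
        unfolding w_def[abs_def] using u(1) by (intro continuous_intros continuous_on_translate)
      have wb: "\<bar>w x\<bar> \<le> 2 * R" for x
        using u(2)[of "x + z"] u(2)[of x] \<sigma> by (auto simp: w_def)
      have wd: "\<epsilon>\<^sup>2 * dlap h w x = q x * w x - \<sigma> * (F (u (x + z)) - F (u x)) + \<sigma> * ((q (x + z) - q x) * u (x + z))" for x
      proof -
        have "dlap h w x = \<sigma> * (dlap h u (x + z) - dlap h u x)"
          unfolding dlap_eq_sum w_def[abs_def] sum_subtractf[symmetric] sum_distrib_left
          by (intro sum.cong) (simp_all add: algebra_simps add_divide_distrib diff_divide_distrib)
        then have "\<epsilon>\<^sup>2 * dlap h w x = \<sigma> * (\<epsilon>\<^sup>2 * dlap h u (x + z) - \<epsilon>\<^sup>2 * dlap h u x)"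
          by (simp add: right_diff_distrib mult.left_commute)
        then show ?thesis unfolding u(3) w_def by (simp add: algebra_simps)
      qed
      have "w x1 \<le> \<tau> + c * (norm (x1 - x1))\<^sup>2"
      proof (rule discrete_comparison[OF wc _ c])
        show "w x \<le> 2 * R" for x using wb[of x] by simp
        show "h \<noteq> 0" using h by simp
        fix x assume x: "w x > \<tau> + c * (norm (x - x1))\<^sup>2"
        then have wx: "w x > \<tau>" using c(1) by (smt (verit) mult_nonneg_nonneg zero_le_power2)
        have "c * (norm (x - x1))\<^sup>2 \<le> c * \<rho>\<^sup>2" using x wb[of x] assms(2) \<rho>(2) by simp
        then have nx: "norm (x - x1) \<le> \<rho>"
          by (intro power2_le_imp_le[OF _ \<rho>(1)]) (rule mult_left_le_imp_le[OF _ c(1)])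
        moreover have "norm (x + z - x1) \<le> \<rho> + 1"
          using norm_triangle_ineq[of "x - x1" z] nx z by (simp add: algebra_simps)
        ultimately have "\<bar>q (x + z) - q x\<bar> < \<tau> / (2 * R)"
          using s0(2)[of x "x + z"] z by (simp add: dist_norm norm_minus_commute)
        then have "\<bar>(q (x + z) - q x) * u (x + z)\<bar> \<le> \<tau> / (2 * R) * R"
          unfolding abs_mult using u(2)[of "x + z"] by (intro mult_mono) auto
        then have "\<bar>\<sigma> * ((q (x + z) - q x) * u (x + z))\<bar> \<le> \<tau> / 2"
          using \<sigma> R_pos by (auto simp: abs_mult)
        moreover have "\<bar>F (u (x + z)) - F (u x)\<bar> \<le> L * w x"
        proof -
          have "\<bar>u (x + z) - u x\<bar> = w x" using \<sigma> wx assms(2) by (auto simp: w_def)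
          then show ?thesis using F_lipschitz[of "u (x + z)" "u x"] by simp
        qed
        then have "q x * w x - \<bar>F (u (x + z)) - F (u x)\<bar> \<ge> w x"
          using wx assms(2) q_ge by (intro zeroth_order_lower_bound) auto
        moreover have "\<sigma> * (F (u (x + z)) - F (u x)) \<le> \<bar>F (u (x + z)) - F (u x)\<bar>"
          using \<sigma> by auto
        ultimately have "\<epsilon>\<^sup>2 * dlap h w x \<ge> \<tau> / 2" unfolding wd using wx by linarith
        then show "dlap h w x \<ge> d" using assms(1) by (simp add: d_def field_simps)
      qed
      then show ?thesis by (simp add: w_def)
    qed
    show "\<bar>u (x1 + z) - u x1\<bar> \<le> \<tau>"
      using one_sided[of 1] one_sided[of "-1"] by simp
  qed
qed

text \<open>Equicontinuity at each point extends convergence from a countable dense set to the whole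
  space and makes the limit continuous. Pointwise convergence suffices, because the uniform bound R
  allows dominated convergence against a test function.\<close>

lemma weak_solution_exists:
  assumes "\<epsilon> > 0"
  shows "\<exists>v. weak_solution \<epsilon> v"
proof -
  define h where "h n = inverse (real (Suc n))" for n
  have h: "h n > 0" "h n \<le> 1" "h \<longlonglongrightarrow> 0" for n
    using LIMSEQ_inverse_real_of_nat by (auto simp: h_def[abs_def] inverse_le_1_iff)
  obtain u where u: "\<And>n. continuous_on UNIV (u n)" "\<And>n x. \<bar>u n x\<bar> \<le> R"
    "\<And>n x. \<epsilon>\<^sup>2 * dlap (h n) (u n) x = q x * u n x - F (u n x)"
    using discrete_solution[OF assms h(1)] by metis
  obtain S :: "'a set" where S: "countable S" "\<And>X. open X \<Longrightarrow> X \<noteq> {} \<Longrightarrow> \<exists>d\<in>S. d \<in> X"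
    using countable_dense_exists by blast
  \<comment> \<open>A diagonal subsequence that converges at every point of the dense set.\<close>
  obtain k where k: "strict_mono k" "\<And>x. x \<in> S \<Longrightarrow> \<exists>l. (\<lambda>n. u (k n) x) \<longlonglongrightarrow> l"
    using function_convergent_subsequence[OF S(1), of u R] u(2) by (metis real_norm_def)
  have equi: "\<exists>s>0. \<forall>n z. norm z < s \<longrightarrow> \<bar>u n (x + z) - u n x\<bar> \<le> \<tau>" if "\<tau> > 0" for x \<tau>
    using discrete_solutions_equicontinuous[OF assms that, of x] u h(1) by meson
  have "Cauchy (\<lambda>n. u (k n) x)" for x
  proof (rule metric_CauchyI)
    fix e :: real assume e: "e > 0"
    obtain s where s: "s > 0" "\<And>n z. norm z < s \<Longrightarrow> \<bar>u n (x + z) - u n x\<bar> \<le> e / 4"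
      using equi[of "e / 4" x] e by auto
    obtain y where y: "y \<in> S" "y \<in> ball x s" using S(2)[of "ball x s"] s(1) by auto
    have close: "\<bar>u n y - u n x\<bar> \<le> e / 4" for n
      using s(2)[of "y - x" n] y(2) by (simp add: dist_norm norm_minus_commute)
    have "Cauchy (\<lambda>n. u (k n) y)" using k(2)[OF y(1)] LIMSEQ_imp_Cauchy by blast
    from metric_CauchyD[OF this, of "e / 4"] e
    obtain n0 where n0: "\<And>m n. m \<ge> n0 \<Longrightarrow> n \<ge> n0 \<Longrightarrow> \<bar>u (k m) y - u (k n) y\<bar> < e / 4"
      by (auto simp: dist_real_def)
    have "dist (u (k m) x) (u (k n) x) < e" if "m \<ge> n0" "n \<ge> n0" for m n
      using close[of "k m"] close[of "k n"] n0[OF that] unfolding dist_real_def by linarith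
    then show "\<exists>n0. \<forall>m\<ge>n0. \<forall>n\<ge>n0. dist (u (k m) x) (u (k n) x) < e" by blast
  qed
  then obtain v where v: "\<And>x. (\<lambda>n. u (k n) x) \<longlonglongrightarrow> v x"
    unfolding Cauchy_convergent_iff convergent_def by metis
  have vR: "\<bar>v x\<bar> \<le> R" for x
    by (rule LIMSEQ_le_const2[OF tendsto_rabs[OF v]]) (use u(2) in auto)
  have vc: "continuous_on UNIV v"
    unfolding continuous_on_iff
  proof (intro ballI allI impI)
    fix x and e :: real assume e: "e > 0"
    obtain s where s: "s > 0" "\<And>n z. norm z < s \<Longrightarrow> \<bar>u n (x + z) - u n x\<bar> \<le> e / 2"
      using equi[of "e / 2" x] e by auto
    have "dist (v y) (v x) < e" if "dist y x < s" for y
    proof -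
      have "\<bar>v y - v x\<bar> \<le> e / 2"
        by (rule LIMSEQ_le_const2[OF tendsto_rabs[OF tendsto_diff[OF v v]]])
           (use s(2)[of "y - x"] that in \<open>auto simp: dist_norm\<close>)
      then show ?thesis using e by (simp add: dist_real_def)
    qed
    with s(1) show "\<exists>d>0. \<forall>y\<in>UNIV. dist y x < d \<longrightarrow> dist (v y) (v x) < e" by blast
  qed
  have "(LINT x|lborel. v x * laplacian \<phi> x) = (LINT x|lborel. (q x * v x - F (v x)) / \<epsilon>\<^sup>2 * \<phi> x)"
    if \<phi>: "test_function \<phi>" for \<phi>
  proof -
    obtain r where r: "r > 0" "\<And>x. norm x > r \<Longrightarrow> \<phi> x = 0" using test_function_support[OF \<phi>] by blast
    note \<phi>c = test_function_continuous[OF \<phi>]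
    \<comment> \<open>q is bounded only on compact sets, so the dominating constant K has to be
      taken for q multiplied by the test function.\<close>
    have "compact ((\<lambda>x. \<bar>\<phi> x\<bar> * (\<bar>q x\<bar> + \<alpha>)) ` cball 0 r)"
      by (intro compact_continuous_image compact_cball continuous_intros continuous_on_subset[OF \<phi>c] continuous_on_subset[OF q_continuous]) auto
    then have "bounded ((\<lambda>x. \<bar>\<phi> x\<bar> * (\<bar>q x\<bar> + \<alpha>)) ` cball 0 r)" by (rule compact_imp_bounded)
    then obtain K where K: "K > 0" "\<forall>y\<in>(\<lambda>x. \<bar>\<phi> x\<bar> * (\<bar>q x\<bar> + \<alpha>)) ` cball 0 r. norm y \<le> K"
      unfolding bounded_pos by blast
    have K': "\<bar>\<phi> x\<bar> * (\<bar>q x\<bar> + \<alpha>) \<le> K" for x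
    proof (cases "norm x \<le> r")
      case True
      then have "norm (\<bar>\<phi> x\<bar> * (\<bar>q x\<bar> + \<alpha>)) \<le> K" using K(2) by (simp add: image_iff)
      then show ?thesis using abs_ge_self order_trans unfolding real_norm_def by blast
    next
      case False
      then show ?thesis using K(1) r(2)[of x] by simp
    qed
    define G where "G n x = (q x * u (k n) x - F (u (k n) x)) / \<epsilon>\<^sup>2 * \<phi> x" for n x
    have "(\<lambda>n. LINT x|lborel. u (k n) x * dlap ((h \<circ> k) n) \<phi> x) \<longlonglongrightarrow> (LINT x|lborel. v x * laplacian \<phi> x)"
      by (rule limit_integral_dlap[OF \<phi>])
         (use h u v vc LIMSEQ_subseq_LIMSEQ[OF h(3) k(1)] in \<open>auto simp: comp_def\<close>)
    moreover have "(LINT x|lborel. u (k n) x * dlap ((h \<circ> k) n) \<phi> x) = (LINT x|lborel. G n x)" for n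
    proof -
      have "(LINT x|lborel. u (k n) x * dlap (h (k n)) \<phi> x) = (LINT x|lborel. dlap (h (k n)) (u (k n)) x * \<phi> x)"
        using h(1)[of "k n"] by (intro dlap_summation_by_parts[symmetric] u \<phi>c) (use r in auto)
      moreover have "dlap (h (k n)) (u (k n)) x = (q x * u (k n) x - F (u (k n) x)) / \<epsilon>\<^sup>2" for x
        using u(3)[of "k n" x, symmetric] assms by simp
      ultimately show ?thesis by (simp add: G_def)
    qed
    ultimately have lim: "(\<lambda>n. LINT x|lborel. G n x) \<longlonglongrightarrow> (LINT x|lborel. v x * laplacian \<phi> x)" by simp
    have "(\<lambda>n. LINT x|lborel. G n x) \<longlonglongrightarrow> (LINT x|lborel. (q x * v x - F (v x)) / \<epsilon>\<^sup>2 * \<phi> x)"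
    proof (rule bounded_limit_integral[where M = "R * K / \<epsilon>\<^sup>2" and r = r])
      show "continuous_on UNIV (G n)" for n
        unfolding G_def[abs_def] by (intro continuous_intros continuous_on_F u q_continuous \<phi>c) (use assms in auto)
      show "continuous_on UNIV (\<lambda>x. (q x * v x - F (v x)) / \<epsilon>\<^sup>2 * \<phi> x)"
        by (intro continuous_intros continuous_on_F vc q_continuous \<phi>c) (use assms in auto)
      show "(\<lambda>n. G n x) \<longlonglongrightarrow> (q x * v x - F (v x)) / \<epsilon>\<^sup>2 * \<phi> x" for x
      proof -
        have "(\<lambda>n. F (u (k n) x)) \<longlonglongrightarrow> F (v x)"
          by (rule isCont_tendsto_compose[OF _ v]) (use F_continuous in \<open>simp add: continuous_on_eq_continuous_at\<close>)
        then show ?thesis unfolding G_def by (intro tendsto_intros v) (use assms in auto)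
      qed
      show "\<bar>G n x\<bar> \<le> R * K / \<epsilon>\<^sup>2" for n x
      proof -
        have "\<bar>q x * u (k n) x - F (u (k n) x)\<bar> \<le> \<bar>q x\<bar> * R + \<alpha> * R"
          using abs_triangle_ineq4[of "q x * u (k n) x" "F (u (k n) x)"] F_bounded[of "u (k n) x"]
            mult_left_mono[OF u(2)[of "k n" x], of "\<bar>q x\<bar>"] by (simp add: abs_mult)
        then have "\<bar>q x * u (k n) x - F (u (k n) x)\<bar> * \<bar>\<phi> x\<bar> \<le> (\<bar>q x\<bar> * R + \<alpha> * R) * \<bar>\<phi> x\<bar>"
          by (rule mult_right_mono) simp
        also have "\<dots> = R * (\<bar>\<phi> x\<bar> * (\<bar>q x\<bar> + \<alpha>))" by (simp add: algebra_simps)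
        also have "\<dots> \<le> R * K" using K'[of x] R_pos by (intro mult_left_mono) auto
        finally show ?thesis by (simp add: G_def abs_mult divide_right_mono)
      qed
      show "G n x = 0" if "norm x > r" for n x using r(2)[OF that] by (simp add: G_def)
    qed
    with lim show ?thesis by (rule LIMSEQ_unique)
  qed
  with vc vR show ?thesis unfolding weak_solution_def by blast
qed

section \<open>Uniqueness\<close>

text \<open>The difference of the solutions is compared at x1 with a paraboloid of opening \<delta>
  whose height k is proportional to \<delta>; letting \<delta> tend to 0 gives the claim. Exchanging
  the two solutions then yields equality.\<close>

lemma weak_solution_le:
  assumes "\<epsilon> > 0" and u: "weak_solution \<epsilon> u" and v: "weak_solution \<epsilon> v"
  shows "u x1 \<le> v x1"
proof -
  define w where "w x = u x - v x" for x
  define g where "g x = (q x * u x - F (u x)) / \<epsilon>\<^sup>2 - (q x * v x - F (v x)) / \<epsilon>\<^sup>2" for x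
  have uc: "continuous_on UNIV u" "continuous_on UNIV v" using u v by (auto simp: weak_solution_def)
  have gu: "continuous_on UNIV (\<lambda>x. (q x * u x - F (u x)) / \<epsilon>\<^sup>2)"
    and gv: "continuous_on UNIV (\<lambda>x. (q x * v x - F (v x)) / \<epsilon>\<^sup>2)"
    using assms(1) by (intro continuous_intros continuous_on_F uc q_continuous; simp)+
  have eq: "(LINT x|lborel. w x * laplacian \<phi> x) = (LINT x|lborel. g x * \<phi> x)" if \<phi>: "test_function \<phi>" for \<phi>
  proof -
    obtain r where r: "\<And>x. norm x > r \<Longrightarrow> \<phi> x = 0" using test_function_support[OF \<phi>] by metis
    have lap0: "laplacian \<phi> x = 0" if "norm x > r" for x
      unfolding laplacian_def using that by (intro sum.neutral ballI pderiv_dir_zero_outside[OF pderiv_dir_zero_outside[OF r]])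
    have int: "integrable lborel (\<lambda>x. a x * \<phi> x)" "integrable lborel (\<lambda>x. a x * laplacian \<phi> x)"
      if "continuous_on UNIV a" for a
      by (rule integrable_continuous_bounded_support[where r = r];
          use that \<phi> r lap0 test_function_continuous test_function_C2(3) in \<open>auto intro!: continuous_intros\<close>)+
    show ?thesis
      unfolding w_def g_def left_diff_distrib
        Bochner_Integration.integral_diff[OF int(2)[OF uc(1)] int(2)[OF uc(2)]]
        Bochner_Integration.integral_diff[OF int(1)[OF gu] int(1)[OF gv]]
      using u v \<phi> by (simp only: weak_solution_def)
  qed
  have "w x1 \<le> 7 * real DIM('a) * \<delta> * \<epsilon>\<^sup>2" if \<delta>: "\<delta> > 0" for \<delta>
  proof -
    \<comment> \<open>Any factor above 2 in place of 7 makes the required lower bound exceed the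
      Laplacian of the paraboloid. The height is that bound times \<open>\<epsilon>\<^sup>2\<close>,
      because w > k forces g \<ge> \<open>k / \<epsilon>\<^sup>2\<close>.\<close>
    define k where "k = 7 * real DIM('a) * \<delta> * \<epsilon>\<^sup>2"
    have k: "k > 0" using \<delta> assms(1) by (simp add: k_def)
    have "w x1 \<le> k + \<delta> * (norm (x1 - x1))\<^sup>2"
    proof (rule distributional_comparison[OF _ _ _ eq \<delta>])
      show "continuous_on UNIV w" "continuous_on UNIV g"
        unfolding w_def[abs_def] g_def[abs_def] using uc gu gv by (auto intro!: continuous_intros)
      show "\<bar>w x\<bar> \<le> 2 * R" for x
      proof -
        have "\<bar>u x\<bar> \<le> R" "\<bar>v x\<bar> \<le> R" using u v by (auto simp: weak_solution_def)
        then show ?thesis by (simp add: w_def)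
      qed
      show "7 * real DIM('a) * \<delta> > 2 * real DIM('a) * \<delta>" using \<delta> by simp
      fix x assume "w x > k + \<delta> * (norm (x - x1))\<^sup>2"
      then have wx: "w x > k" using \<delta> by (smt (verit) mult_nonneg_nonneg zero_le_power2)
      have "\<bar>F (u x) - F (v x)\<bar> \<le> L * w x"
        using F_lipschitz[of "u x" "v x"] wx k by (simp add: w_def)
      then have "q x * w x - \<bar>F (u x) - F (v x)\<bar> \<ge> w x"
        using wx k q_ge by (intro zeroth_order_lower_bound) auto
      then have "q x * w x - (F (u x) - F (v x)) \<ge> k" using wx by linarith
      then have "(q x * w x - (F (u x) - F (v x))) / \<epsilon>\<^sup>2 \<ge> k / \<epsilon>\<^sup>2" by (rule divide_right_mono) simp
      also have "(q x * w x - (F (u x) - F (v x))) / \<epsilon>\<^sup>2 = g x"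
        unfolding g_def w_def diff_divide_distrib[symmetric] by (simp add: algebra_simps)
      finally show "g x \<ge> 7 * real DIM('a) * \<delta>" using assms(1) by (simp add: k_def)
    qed
    then show ?thesis by (simp add: k_def)
  qed
  from this[of "e / (7 * real DIM('a) * \<epsilon>\<^sup>2)" for e] have "w x1 \<le> 0 + e" if "e > 0" for e
    using that assms(1) by simp
  then have "w x1 \<le> 0" by (rule field_le_epsilon)
  then show ?thesis by (simp add: w_def)
qed

lemma weak_solution_unique:
  "\<epsilon> > 0 \<Longrightarrow> weak_solution \<epsilon> u \<Longrightarrow> weak_solution \<epsilon> v \<Longrightarrow> u = v"
  by (rule ext, rule antisym; rule weak_solution_le)

section \<open>The singular limit\<close>

text \<open>The bound |F| \<le> \<alpha> R \<le> q x R fixes the signs of q x s - F s at s = -R and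
  s = R.\<close>

lemma algebraic_root_exists: "\<exists>s. \<bar>s\<bar> \<le> R \<and> q x * s = F s"
proof -
  have *: "\<alpha> * R \<le> q x * R" using q_ge[of x] R_pos by (intro mult_right_mono) auto
  have "\<exists>s\<ge>-R. s \<le> R \<and> q x * s - F s = 0"
  proof (rule IVT')
    show "q x * (-R) - F (-R) \<le> 0" "0 \<le> q x * R - F R"
      using * F_bounded[of R] F_bounded[of "-R"] by auto
    show "continuous_on {-R..R} (\<lambda>s. q x * s - F s)"
      by (intro continuous_intros continuous_on_subset[OF F_continuous]) auto
  qed (use R_pos in auto)
  then show ?thesis by (auto simp: abs_le_iff)
qed

text \<open>The constant s solves the equation with q frozen at x0, so near x0 it is an approximate
  solution with error (q x - q x0) s, at most \<delta>/2. Where u is off by more than \<delta> the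
  zeroth-order part exceeds \<delta>, and \<delta>/2 survives. Division by
  \<open>\<epsilon>\<^sup>2\<close> makes this as large as desired, which pays for a steep
  paraboloid.\<close>

lemma weak_solution_near_root:
  assumes "\<bar>s\<bar> \<le> R" "q x0 * s = F s" "\<delta> > 0"
  shows "\<exists>\<epsilon>0>0. \<forall>\<epsilon> u. 0 < \<epsilon> \<and> \<epsilon> < \<epsilon>0 \<and> weak_solution \<epsilon> u \<longrightarrow> \<bar>u x0 - s\<bar> \<le> \<delta>"
proof -
  have "isCont q x0" using q_continuous by (simp add: continuous_on_eq_continuous_at)
  moreover have "\<delta> / (2 * R) > 0" using assms R_pos by simp
  ultimately obtain \<rho> where \<rho>: "\<rho> > 0" "\<And>x. dist x x0 < \<rho> \<Longrightarrow> dist (q x) (q x0) < \<delta> / (2 * R)"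
    unfolding continuous_at_eps_delta by blast
  \<comment> \<open>The paraboloid reaches 2 R, the largest possible value of |u - s|, at distance
    \<rho>, so only points where q is close to q x0 have to be examined.\<close>
  define c where "c = 2 * R / \<rho>\<^sup>2"
  have c: "c > 0" "c * \<rho>\<^sup>2 = 2 * R" using \<rho>(1) R_pos by (simp_all add: c_def)
  \<comment> \<open>Below this threshold \<open>\<delta> / (2 * \<epsilon>\<^sup>2)\<close> exceeds
    the Laplacian of the paraboloid.\<close>
  define \<epsilon>0 where "\<epsilon>0 = sqrt (\<delta> / (4 * real DIM('a) * c))"
  have \<epsilon>0: "\<epsilon>0 > 0" "\<epsilon>0\<^sup>2 = \<delta> / (4 * real DIM('a) * c)" using assms(3) c(1) by (simp_all add: \<epsilon>0_def)
  show ?thesis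
  proof (intro exI[of _ \<epsilon>0] conjI allI impI)
    fix \<epsilon> u assume "0 < \<epsilon> \<and> \<epsilon> < \<epsilon>0 \<and> weak_solution \<epsilon> u"
    then have \<epsilon>: "0 < \<epsilon>" "\<epsilon> < \<epsilon>0" and u: "continuous_on UNIV u" "\<And>x. \<bar>u x\<bar> \<le> R"
      "\<And>\<phi>. test_function \<phi> \<Longrightarrow>
       (LINT x|lborel. u x * laplacian \<phi> x) = (LINT x|lborel. (q x * u x - F (u x)) / \<epsilon>\<^sup>2 * \<phi> x)"
      by (auto simp: weak_solution_def)
    have "\<epsilon>\<^sup>2 < \<epsilon>0\<^sup>2" using \<epsilon> by (intro power_strict_mono) auto
    then have d: "\<delta> / (2 * \<epsilon>\<^sup>2) > 2 * real DIM('a) * c"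
      unfolding \<epsilon>0(2) using \<epsilon>(1) c(1) by (simp add: field_simps)
    have one_sided: "\<sigma> * (u x0 - s) \<le> \<delta>" if \<sigma>: "\<sigma> = 1 \<or> \<sigma> = -1" for \<sigma> :: real
    proof -
      have "\<sigma> * u x0 \<le> (\<delta> + \<sigma> * s) + c * (norm (x0 - x0))\<^sup>2"
      proof (rule distributional_comparison[where M = R and g = "\<lambda>x. \<sigma> * ((q x * u x - F (u x)) / \<epsilon>\<^sup>2)", OF _ _ _ _ c(1) d])
        show "continuous_on UNIV (\<lambda>x. \<sigma> * u x)" by (intro continuous_intros u)
        show "continuous_on UNIV (\<lambda>x. \<sigma> * ((q x * u x - F (u x)) / \<epsilon>\<^sup>2))"
          using \<epsilon>(1) by (intro continuous_intros continuous_on_F u q_continuous) simp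
        show "\<bar>\<sigma> * u x\<bar> \<le> R" for x using u(2)[of x] \<sigma> by auto
        show "(LINT x|lborel. \<sigma> * u x * laplacian \<phi> x) = (LINT x|lborel. \<sigma> * ((q x * u x - F (u x)) / \<epsilon>\<^sup>2) * \<phi> x)"
          if "test_function \<phi>" for \<phi>
          using u(3)[OF that] by (simp only: mult.assoc integral_mult_right_zero)
        fix x assume x: "\<sigma> * u x > (\<delta> + \<sigma> * s) + c * (norm (x - x0))\<^sup>2"
        define w where "w = \<sigma> * (u x - s)"
        have x': "w > \<delta> + c * (norm (x - x0))\<^sup>2" using x by (simp add: w_def right_diff_distrib)
        then have wx: "w > \<delta>" using c(1) by (smt (verit) mult_nonneg_nonneg zero_le_power2)
        have "w \<le> 2 * R" using \<sigma> u(2)[of x] assms(1) by (auto simp: w_def)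
        then have "c * (norm (x - x0))\<^sup>2 < c * \<rho>\<^sup>2" using x' assms(3) c(2) by linarith
        then have "norm (x - x0) < \<rho>"
          using c(1) \<rho>(1) by (intro power2_less_imp_less[of _ \<rho>]) (auto simp: mult_less_cancel_left)
        then have "\<bar>q x - q x0\<bar> < \<delta> / (2 * R)" using \<rho>(2)[of x] by (simp add: dist_norm)
        then have "\<bar>(q x - q x0) * s\<bar> \<le> \<delta> / (2 * R) * R"
          unfolding abs_mult using assms(1) by (intro mult_mono) auto
        then have "\<bar>\<sigma> * ((q x - q x0) * s)\<bar> \<le> \<delta> / 2"
          using \<sigma> R_pos by (auto simp: abs_mult)
        moreover have "\<bar>F (u x) - F s\<bar> \<le> L * w"
        proof -
          have "\<bar>u x - s\<bar> = w" using \<sigma> wx assms(3) by (auto simp: w_def)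
          then show ?thesis using F_lipschitz[of "u x" s] by simp
        qed
        then have "q x * w - \<bar>F (u x) - F s\<bar> \<ge> w"
          using wx assms(3) q_ge by (intro zeroth_order_lower_bound) auto
        moreover have "\<sigma> * (F (u x) - F s) \<le> \<bar>F (u x) - F s\<bar>"
          using \<sigma> by auto
        moreover have "\<sigma> * (q x * u x - F (u x)) = q x * w - \<sigma> * (F (u x) - F s) + \<sigma> * ((q x - q x0) * s)"
          using assms(2) by (simp add: w_def algebra_simps)
        ultimately have "\<sigma> * (q x * u x - F (u x)) \<ge> \<delta> / 2" using wx by linarith
        from divide_right_mono[OF this, of "\<epsilon>\<^sup>2"]
        show "\<sigma> * ((q x * u x - F (u x)) / \<epsilon>\<^sup>2) \<ge> \<delta> / (2 * \<epsilon>\<^sup>2)" by simp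
      qed
      then show ?thesis by (simp add: right_diff_distrib)
    qed
    show "\<bar>u x0 - s\<bar> \<le> \<delta>"
      using one_sided[of 1] one_sided[of "-1"] by simp
  qed (rule \<epsilon>0)
qed

end


section \<open>Reduction of the stated problem to the truncated equation\<close>

lemma smooth_real_bounded_lipschitz_on_interval:
  fixes f :: "real \<Rightarrow> real"
  assumes "smooth f"
  obtains L B where "L \<ge> 0" "B \<ge> 0" "\<And>s. \<bar>s\<bar> \<le> R \<Longrightarrow> \<bar>f s\<bar> \<le> B"
    "\<And>s t. \<bar>s\<bar> \<le> R \<Longrightarrow> \<bar>t\<bar> \<le> R \<Longrightarrow> \<bar>f s - f t\<bar> \<le> L * \<bar>s - t\<bar>"
proof -
  let ?I = "{-R..R}"
  have fc: "continuous_on UNIV f" and C1: "C_k (Suc 0) f"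
    using assms unfolding smooth_def using C_k.simps(1) by blast+
  then have dc: "continuous_on UNIV (pderiv_dir 1 f)" by simp
  have "bounded (f ` ?I)" "bounded (pderiv_dir 1 f ` ?I)"
    by (rule compact_imp_bounded[OF compact_continuous_image[OF continuous_on_subset[OF fc]]], auto)
       (rule compact_imp_bounded[OF compact_continuous_image[OF continuous_on_subset[OF dc]]], auto)
  then obtain B L where B: "B > 0" "\<forall>y\<in>f ` ?I. norm y \<le> B" and L: "L > 0" "\<forall>y\<in>pderiv_dir 1 f ` ?I. norm y \<le> L"
    unfolding bounded_pos by blast
  have deriv: "(f has_field_derivative pderiv_dir 1 f t) (at t within ?I)" for t
    using C_k_Suc_directional_derivative[OF C1, of 0 1 t] by (simp add: has_field_derivative_at_within)
  have "norm (f s - f t) \<le> L * norm (s - t)" if "\<bar>s\<bar> \<le> R" "\<bar>t\<bar> \<le> R" for s t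
    by (rule field_differentiable_bound[of ?I f "pderiv_dir 1 f"]) (use deriv L(2) that in auto)
  with B L show ?thesis by (intro that[of L B]) (auto simp: abs_le_iff)
qed

text \<open>A real \<open>SUP\<close> is an upper bound only if the range is bounded above; the
  boundedness contained in \<open>B_ball\<close> supplies this.\<close>

lemma B_ball_iff: "R > 0 \<Longrightarrow> u \<in> B_ball R \<longleftrightarrow> continuous_on UNIV u \<and> (\<forall>x. \<bar>u x\<bar> \<le> R)"
proof safe
  fix x assume u: "u \<in> B_ball R"
  then obtain b where "\<And>x. \<bar>u x\<bar> \<le> b" unfolding B_ball_def bounded_iff by auto
  then have "\<bar>u x\<bar> \<le> (SUP x. \<bar>u x\<bar>)" by (intro cSUP_upper bdd_aboveI2[where M = b]) auto
  with u show "\<bar>u x\<bar> \<le> R" by (simp add: B_ball_def)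
next
  assume "continuous_on UNIV u" "\<forall>x. \<bar>u x\<bar> \<le> R"
  then show "u \<in> B_ball R" unfolding B_ball_def bounded_iff by (auto intro!: cSUP_least)
qed (simp add: B_ball_def)

text \<open>Inside the ball F and f agree and boundedness at infinity is automatic. What remains is
  to split the integral of the right-hand side, whose parts are continuous with bounded
  support.\<close>

lemma weak_solution_iff:
  fixes q :: "real^3 \<Rightarrow> real"
  assumes abs: "absorption F L \<alpha> R q" and F: "\<And>s. \<bar>s\<bar> \<le> R \<Longrightarrow> F s = f s" and \<epsilon>: "\<epsilon> > 0"
  shows "absorption.weak_solution F R q \<epsilon> u \<longleftrightarrow> u \<in> B_ball R \<and> solves_problem \<epsilon> q f u"
proof -
  interpret absorption F L \<alpha> R q by (rule abs)
  have *: "weak_solution \<epsilon> u \<longleftrightarrow> solves_problem \<epsilon> q f u"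
    if u: "continuous_on UNIV u" "\<forall>x. \<bar>u x\<bar> \<le> R"
  proof -
    have "(- (\<epsilon>\<^sup>2 * (LINT x|lborel. u x * laplacian \<phi> x)) + (LINT x|lborel. q x * u x * \<phi> x) = (LINT x|lborel. f (u x) * \<phi> x))
       \<longleftrightarrow> (LINT x|lborel. u x * laplacian \<phi> x) = (LINT x|lborel. (q x * u x - F (u x)) / \<epsilon>\<^sup>2 * \<phi> x)"
      if \<phi>: "test_function \<phi>" for \<phi>
    proof -
      obtain r where r: "\<And>x. norm x > r \<Longrightarrow> \<phi> x = 0" using test_function_support[OF \<phi>] by metis
      have int: "integrable lborel (\<lambda>x. q x * u x * \<phi> x)" "integrable lborel (\<lambda>x. F (u x) * \<phi> x)"
        by (rule integrable_continuous_bounded_support[where r = r];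
            use r in \<open>auto intro!: continuous_intros continuous_on_F u q_continuous test_function_continuous[OF \<phi>]\<close>)+
      have "(LINT x|lborel. (q x * u x - F (u x)) / \<epsilon>\<^sup>2 * \<phi> x) = (LINT x|lborel. (q x * u x * \<phi> x - F (u x) * \<phi> x) / \<epsilon>\<^sup>2)"
        by (simp add: left_diff_distrib)
      also have "\<dots> = ((LINT x|lborel. q x * u x * \<phi> x) - (LINT x|lborel. F (u x) * \<phi> x)) / \<epsilon>\<^sup>2"
        by (simp only: integral_divide_zero Bochner_Integration.integral_diff[OF int])
      also have "(LINT x|lborel. F (u x) * \<phi> x) = (LINT x|lborel. f (u x) * \<phi> x)"
        using F u(2) by simp
      finally show ?thesis using \<epsilon> by (auto simp: field_simps)
    qed
    moreover have "bounded_at_infinity u"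
      unfolding bounded_at_infinity_def using u(2) by (intro exI[of _ R]) simp
    ultimately show ?thesis
      using u unfolding weak_solution_def solves_problem_def distributional_solution_def by auto
  qed
  then show ?thesis unfolding B_ball_iff[OF R_pos] weak_solution_def by blast
qed

text \<open>For u = 0 the equation tested with a bump reduces to f 0 times a positive integral being
  0.\<close>

lemma solves_problem_nontrivial:
  assumes "solves_problem \<epsilon> q f u" "f 0 \<noteq> 0"
  shows "\<exists>x. u x \<noteq> 0"
proof (rule ccontr)
  assume "\<not> ?thesis"
  then have u: "u x = 0" for x by simp
  have "test_function (\<lambda>x. 1 * bump 0 1 x :: real)" by (rule test_function_scaled_bump) simp
  with assms(1) have "f 0 * (LINT x|lborel. bump (0::real^3) 1 x) = 0"
    unfolding solves_problem_def distributional_solution_def u by fastforce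
  with assms(2) integral_bump_pos[of 1 "0::real^3"] show False by simp
qed

theorem mainTheorem3:
  fixes f :: "real \<Rightarrow> real" and R :: real
  assumes "smooth f" and "R > 0"
  shows "\<exists>a\<^sub>0>0. \<forall>a\<ge>a\<^sub>0. \<forall>q :: real^3 \<Rightarrow> real.
    continuous_on UNIV q \<and> (\<forall>x. q x \<ge> a\<^sup>2) \<longrightarrow>
      (\<forall>\<epsilon>>0. (\<exists>!u. u \<in> B_ball R \<and> solves_problem \<epsilon> q f u) \<and>
         (f 0 \<noteq> 0 \<longrightarrow> (\<forall>u. u \<in> B_ball R \<and> solves_problem \<epsilon> q f u \<longrightarrow> (\<exists>x. u x \<noteq> 0)))) \<and>
      (\<forall>u\<^sub>0>0. mono_on {u\<^sub>0..} (\<lambda>s. f s / s) \<and> filterlim (\<lambda>s. f s / s) at_top at_top \<and>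
           f u\<^sub>0 / u\<^sub>0 < a\<^sup>2 \<longrightarrow>
         (\<forall>U. (\<forall>\<epsilon>>0. U \<epsilon> \<in> B_ball R \<and> solves_problem \<epsilon> q f (U \<epsilon>)) \<longrightarrow>
            (\<exists>u. (\<forall>x. ((\<lambda>\<epsilon>. U \<epsilon> x) \<longlongrightarrow> u x) (at_right 0)) \<and> (\<forall>x. q x * u x = f (u x)))))"
proof -
  obtain L B where L: "L \<ge> 0" "B \<ge> 0" "\<And>s. \<bar>s\<bar> \<le> R \<Longrightarrow> \<bar>f s\<bar> \<le> B"
    "\<And>s t. \<bar>s\<bar> \<le> R \<Longrightarrow> \<bar>t\<bar> \<le> R \<Longrightarrow> \<bar>f s - f t\<bar> \<le> L * \<bar>s - t\<bar>"
    using smooth_real_bounded_lipschitz_on_interval[OF assms(1)] by metis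
  \<comment> \<open>Composing with the retraction onto \<open>[-R, R]\<close> makes \<open>f\<close> globally bounded and Lipschitz
    without affecting functions in the ball.\<close>
  define F where "F s = f (max (- R) (min R s))" for s
  have F_eq: "F s = f s" if "\<bar>s\<bar> \<le> R" for s
    using that by (simp add: F_def abs_le_iff max_absorb2 min_absorb2)
  have F_le: "\<bar>F s\<bar> \<le> B" for s
    unfolding F_def using assms(2) by (intro L(3)) auto
  have F_lip: "\<bar>F s - F t\<bar> \<le> L * \<bar>s - t\<bar>" for s t
  proof -
    have "\<bar>F s - F t\<bar> \<le> L * \<bar>max (- R) (min R s) - max (- R) (min R t)\<bar>"
      unfolding F_def using assms(2) by (intro L(4)) auto
    also have "\<dots> \<le> L * \<bar>s - t\<bar>" using L(1) by (intro mult_left_mono) auto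
    finally show ?thesis .
  qed
  \<comment> \<open>The summand 1 gives \<open>a\<^sup>2 \<ge> a\<close>, so
    \<open>a\<^sup>2\<close> dominates both L + 1 (the margin) and B / R (the bound on F).\<close>
  define a\<^sub>0 where "a\<^sub>0 = 1 + L + B / R"
  have "B / R \<ge> 0" using L(2) assms(2) by simp
  show ?thesis
  proof (intro exI[of _ a\<^sub>0] conjI allI impI)
    show "a\<^sub>0 > 0" using L(1) \<open>B / R \<ge> 0\<close> by (simp add: a\<^sub>0_def)
  next
    fix a :: real and q :: "real^3 \<Rightarrow> real"
    assume a: "a \<ge> a\<^sub>0" and q: "continuous_on UNIV q \<and> (\<forall>x. q x \<ge> a\<^sup>2)"
    have "a \<ge> 1" using a L(1) \<open>B / R \<ge> 0\<close> by (simp add: a\<^sub>0_def)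
    then have a2: "a\<^sup>2 \<ge> a" by (simp add: power2_eq_square mult_le_cancel_left1)
    have "absorption F L (a\<^sup>2) R q"
    proof
      have "B / R \<le> a\<^sup>2" using a a2 L(1) by (simp add: a\<^sub>0_def)
      then have "B \<le> a\<^sup>2 * R" using assms(2) by (simp add: field_simps)
      then show "\<bar>F s\<bar> \<le> a\<^sup>2 * R" for s using F_le[of s] by linarith
      show "a\<^sup>2 \<ge> L + 1" using a a2 \<open>B / R \<ge> 0\<close> by (simp add: a\<^sub>0_def)
    qed (use F_lip L(1) q assms(2) in auto)
    then interpret absorption F L "a\<^sup>2" R q .
    have sol_iff: "weak_solution \<epsilon> u \<longleftrightarrow> u \<in> B_ball R \<and> solves_problem \<epsilon> q f u" if "\<epsilon> > 0" for \<epsilon> u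
      by (rule weak_solution_iff[OF absorption_axioms _ that]) (rule F_eq)
    {
      fix \<epsilon> :: real assume \<epsilon>: "\<epsilon> > 0"
      have "\<exists>!u. weak_solution \<epsilon> u"
        using weak_solution_exists[OF \<epsilon>] weak_solution_unique[OF \<epsilon>] by (rule ex_ex1I)
      then show "\<exists>!u. u \<in> B_ball R \<and> solves_problem \<epsilon> q f u"
        by (simp only: sol_iff[OF \<epsilon>])
    next
      fix \<epsilon> :: real and u assume "f 0 \<noteq> 0" "u \<in> B_ball R \<and> solves_problem \<epsilon> q f u"
      then show "\<exists>x. u x \<noteq> 0" using solves_problem_nontrivial by blast
    next
      fix U assume U: "\<forall>\<epsilon>>0. U \<epsilon> \<in> B_ball R \<and> solves_problem \<epsilon> q f (U \<epsilon>)"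
      \<comment> \<open>The limit is a choice of root at each x separately. The roots lie in
        \<open>[-R, R]\<close>, so the limiting equation holds with f in place of F.\<close>
      obtain u where u: "\<And>x. \<bar>u x\<bar> \<le> R" "\<And>x. q x * u x = F (u x)"
        using algebraic_root_exists by metis
      have "((\<lambda>\<epsilon>. U \<epsilon> x) \<longlongrightarrow> u x) (at_right 0)" for x
      proof (rule tendstoI)
        fix e :: real assume e: "e > 0"
        then have "e / 2 > 0" by simp
        from weak_solution_near_root[where ?x0.0 = x, OF u this]
        obtain \<epsilon>0 where \<epsilon>0: "\<epsilon>0 > 0"
          "\<And>\<epsilon> v. 0 < \<epsilon> \<Longrightarrow> \<epsilon> < \<epsilon>0 \<Longrightarrow> weak_solution \<epsilon> v \<Longrightarrow> \<bar>v x - u x\<bar> \<le> e / 2"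
          by blast
        have "dist (U \<epsilon> x) (u x) < e" if \<epsilon>: "0 < \<epsilon>" "\<epsilon> < \<epsilon>0" for \<epsilon>
        proof -
          have "weak_solution \<epsilon> (U \<epsilon>)" using U \<epsilon>(1) sol_iff by blast
          from \<epsilon>0(2)[OF \<epsilon> this] e show ?thesis by (simp add: dist_real_def)
        qed
        then show "\<forall>\<^sub>F \<epsilon> in at_right 0. dist (U \<epsilon> x) (u x) < e"
          unfolding eventually_at_right_field using \<epsilon>0(1) by blast
      qed
      then show "\<exists>u. (\<forall>x. ((\<lambda>\<epsilon>. U \<epsilon> x) \<longlongrightarrow> u x) (at_right 0)) \<and> (\<forall>x. q x * u x = f (u x))"
        using u(2) F_eq[OF u(1)] by (intro exI[of _ u] conjI allI) (blast, metis)
    }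
  qed
qed

end
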